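(* Let $z,z',\xi\in\mathbb C$ with $\xi\ne1$. For every partition $\nu\in\mathbb Y$, the Meixner symmetric function $\mathfrak M_\nu$ with parameters $(z,z',\xi)$ is an eigenvector of the Meixner operator $\mathfrak D^{\mathsf M}:\mathrm{Sym}_{\mathbb C}\to\mathrm{Sym}_{\mathbb C}$ with the same parameters: $$\mathfrak D^{\mathsf M}\mathfrak M_\nu=-|\nu|\,\mathfrak M_\nu .$$
   Context: $\mathbb Y$ is the set of all partitions, identified with Young diagrams; $|\nu|$ is the number of boxes and $\ell(\nu)$ the number of nonzero rows of $\nu$. $\mathrm{Sym}$ is the algebra of symmetric functions over $\mathbb R$, with power sums $p_k$ as free generators; $\mathrm{Sym}_{\mathbb C}=\mathrm{Sym}\otimes_{\mathbb R}\mathbb C$. For a box $\square=(i,j)$ (row $i$, column $j$) its content is $c(\square)=j-i$; for $\mu\subseteq\nu$, $(z)_{\nu/\mu}=\prod_{\square\in\nu/\mu}(z+c(\square))$, and $\dim\nu/\mu$ is the number of standard tableaux of skew shape $\nu/\mu$ (equal to $1$ if $\mu=\nu$). $\nu^-$ is the set of boxes $\square\in\nu$ such that $\nu\setminus\square$ is again a Young diagram. Frobenius–Schur functions. Put $x^{\downarrow n}=x(x-1)\cdots(x-n+1)$. The factorial Schur polynomial is $S^{\mathsf f}_{\nu\mid N}(x_1,\dots,x_N)=\det[x_j^{\downarrow(\nu_i+N-i)}]_{i,j=1}^N/\prod_{i<j}(x_i-x_j)$ for $\ell(\nu)\le N$ (and $0$ if $\ell(\nu)>N$). The shifted Schur polynomial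 is $S^*_{\nu\mid N}(y_1,\dots,y_N)=S^{\mathsf f}_{\nu\mid N}(y_1+N-1,y_2+N-2,\dots,y_N)$; it satisfies $S^*_{\nu\mid N}|_{y_N=0}=S^*_{\nu\mid N-1}$. A polynomial in $y_1,\dots,y_N$ is shifted symmetric if it is symmetric in the variables $y_i+N-i$; $\mathrm{Sym}^*$ is the algebra of sequences $(f_N)_{N\ge1}$ of shifted symmetric polynomials in $N$ variables with $f_N|_{y_N=0}=f_{N-1}$ and $\sup_N\deg f_N<\infty$. Thus $S^*_\nu=(S^*_{\nu\mid N})_N\in\mathrm{Sym}^*$. The algebra $\mathrm{Sym}^*$ is freely generated by $p_k^*=\sum_{i\ge1}[(y_i-i+\frac12)^k-(-i+\frac12)^k]$, $k\ge1$, and $FS_\nu\in\mathrm{Sym}$ is the image of $S^*_\nu$ under the algebra isomorphism $\mathrm{Sym}^*\to\mathrm{Sym}$, $p^*_k\mapsto p_k$. The $FS_\nu$ form a basis of $\mathrm{Sym}$. The Meixner symmetric function with index $\nu$ and parameters $(z,z',\xi)$ is $$\mathfrak M_\nu=\sum_{\mu\subseteq\nu}(-1)^{|\nu|-|\mu|}\left(\frac{\xi}{1-\xi}\right)^{|\nu|-|\mu|}\frac{\dim\nu/\mu}{(|\nu|-|\mu|)!}(z)_{\nu/\mu}(z')_{\nu/\mu}\,FS_\mu .$$ The Meixner operator with parameters $(z,z',\xi)$ is the linear operator on $\mathrm{Sym}_{\mathbb C}$ defined by $$\mathfrak D^{\mathsf M}FS_\nu=-|\nu|FS_\nu+\frac{\xi}{1-\xi}\sum_{\square\in\nu^-}(z+c(\square))(z'+c(\square))FS_{\nu\setminus\square},\qquad\nu\in\mathbb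 Y.$$ *)

theory Defs
  imports
    Complex_Main
    "HOL-Library.FuncSet"
    "HOL-Library.Poly_Mapping"
    "Jordan_Normal_Form.Determinant"
begin

section \<open>Young diagrams\<close>

text \<open>Partitions are identified with their Young diagrams, i.e. finite sets of boxes
  \<open>(i, j)\<close> (row, column) closed under moving up and to the left. Rows and columns are
  numbered from 0, which does not affect the content \<open>j - i\<close>.\<close>

type_synonym diagram = "(nat \<times> nat) set"

definition young :: "diagram set" where
  "young = {\<nu>. finite \<nu> \<and>
     (\<forall>i j i' j'. (i, j) \<in> \<nu> \<longrightarrow> i' \<le> i \<longrightarrow> j' \<le> j \<longrightarrow> (i', j') \<in> \<nu>)}"

definition row_len :: "diagram \<Rightarrow> nat \<Rightarrow> nat" where
  "row_len \<nu> i = card {j. (i, j) \<in> \<nu>}"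

definition num_rows :: "diagram \<Rightarrow> nat" where
  "num_rows \<nu> = card {i. row_len \<nu> i \<noteq> 0}"

definition content :: "nat \<times> nat \<Rightarrow> int" where
  "content b = int (snd b) - int (fst b)"

definition removable :: "diagram \<Rightarrow> diagram" where
  "removable \<nu> = {b \<in> \<nu>. \<nu> - {b} \<in> young}"

text \<open>Standard fillings of a skew shape \<open>s\<close>; the functions are \<open>undefined\<close> outside \<open>s\<close>,
  so that they can be counted. For \<open>s = {}\<close> there is exactly one.\<close>

definition standard_tableaux :: "diagram \<Rightarrow> (nat \<times> nat \<Rightarrow> nat) set" where
  "standard_tableaux s = {T \<in> extensional s. bij_betw T s {1..card s} \<and>
     (\<forall>i j j'. (i, j) \<in> s \<longrightarrow> (i, j') \<in> s \<longrightarrow> j < j' \<longrightarrow> T (i, j) < T (i, j')) \<and>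
     (\<forall>i i' j. (i, j) \<in> s \<longrightarrow> (i', j) \<in> s \<longrightarrow> i < i' \<longrightarrow> T (i, j) < T (i', j))}"

definition skew_dim :: "diagram \<Rightarrow> diagram \<Rightarrow> nat" where
  "skew_dim \<nu> \<mu> = card (standard_tableaux (\<nu> - \<mu>))"

definition skew_poch :: "complex \<Rightarrow> diagram \<Rightarrow> diagram \<Rightarrow> complex" where
  "skew_poch z \<nu> \<mu> = (\<Prod>b \<in> \<nu> - \<mu>. z + of_int (content b))"


section \<open>Polynomials in the variables indexed by the natural numbers\<close>

type_synonym 'a mpol = "(nat \<Rightarrow>\<^sub>0 nat) \<Rightarrow>\<^sub>0 'a"

definition Const :: "'a::zero \<Rightarrow> 'a mpol" where
  "Const c = Poly_Mapping.single 0 c"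

definition Var :: "nat \<Rightarrow> 'a::zero_neq_one mpol" where
  "Var i = Poly_Mapping.single (Poly_Mapping.single i 1) 1"

definition scale :: "'a::comm_ring_1 \<Rightarrow> 'a mpol \<Rightarrow> 'a mpol" where
  "scale c f = Const c * f"

text \<open>The substitution homomorphism \<open>Var i \<mapsto> g i\<close>.\<close>

definition subst :: "(nat \<Rightarrow> 'a mpol) \<Rightarrow> 'a mpol \<Rightarrow> 'a::comm_ring_1 mpol" where
  "subst g f = (\<Sum>m \<in> Poly_Mapping.keys f. scale (Poly_Mapping.lookup f m)
     (\<Prod>i \<in> Poly_Mapping.keys m. g i ^ Poly_Mapping.lookup m i))"


section \<open>Frobenius--Schur functions\<close>

text \<open>When a polynomial is regarded as a polynomial in \<open>x\<^sub>1, \<dots>, x\<^sub>N\<close> (or \<open>y\<^sub>1, \<dots>, y\<^sub>N\<close>),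
  the variable \<open>x\<^sub>i\<close> is \<open>Var (i - 1)\<close>. Below, \<open>i\<close> and \<open>j\<close> thus run from \<open>0\<close> to \<open>N - 1\<close>, and
  expressions like \<open>\<nu>\<^sub>i + N - i\<close> become \<open>row_len \<nu> i + N - 1 - i\<close>.\<close>

definition falling :: "'a::comm_ring_1 \<Rightarrow> nat \<Rightarrow> 'a" where
  "falling x n = (\<Prod>k<n. x - of_nat k)"

definition vandermonde :: "nat \<Rightarrow> real mpol" where
  "vandermonde N = (\<Prod>(i, j) \<in> {(i, j). i < j \<and> j < N}. Var i - Var j)"

text \<open>The quotient is taken in the polynomial ring, which is an integral domain.\<close>

definition factorial_schur :: "diagram \<Rightarrow> nat \<Rightarrow> real mpol" where
  "factorial_schur \<nu> N =
     (if num_rows \<nu> \<le> N then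
        (THE q. q * vandermonde N =
           det (mat N N (\<lambda>(i, j). falling (Var j) (row_len \<nu> i + N - 1 - i))))
      else 0)"

definition shifted_schur :: "diagram \<Rightarrow> nat \<Rightarrow> real mpol" where
  "shifted_schur \<nu> N = subst (\<lambda>i. Var i + of_nat (N - 1 - i)) (factorial_schur \<nu> N)"

text \<open>\<open>pstar k N\<close> is \<open>p\<^sup>*\<^sub>k\<close> restricted to \<open>N\<close> variables; the terms with \<open>i > N\<close> vanish as
  \<open>y\<^sub>i = 0\<close> there. The constant \<open>- i + 1/2\<close> reads \<open>- i - 1/2\<close> for \<open>i\<close> counted from 0.\<close>

definition pstar :: "nat \<Rightarrow> nat \<Rightarrow> real mpol" where
  "pstar k N = (\<Sum>i<N. (Var i + Const (- real i - 1/2)) ^ k - Const ((- real i - 1/2) ^ k))"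

text \<open>\<open>Sym\<close> is the polynomial algebra in its free generators \<open>p\<^sub>1, p\<^sub>2, \<dots>\<close>, with \<open>p\<^sub>k\<close>
  represented by \<open>Var (k - 1)\<close>. Elements of \<open>Sym\<^sup>*\<close> are sequences \<open>(f\<^sub>N)\<close>, \<open>N \<ge> 1\<close>. As \<open>Sym\<^sup>*\<close>
  is freely generated by the \<open>p\<^sup>*\<^sub>k\<close>, the isomorphism \<open>p\<^sup>*\<^sub>k \<mapsto> p\<^sub>k\<close> sends a sequence \<open>f\<close> to the
  unique \<open>F\<close> with \<open>f = F(p\<^sup>*\<^sub>1, p\<^sup>*\<^sub>2, \<dots>)\<close>.\<close>

type_synonym 'a sym = "'a mpol"

definition symstar_to_sym :: "(nat \<Rightarrow> real mpol) \<Rightarrow> real sym" where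
  "symstar_to_sym f = (THE F. \<forall>N\<ge>1. subst (\<lambda>k. pstar (Suc k) N) F = f N)"

definition FS :: "diagram \<Rightarrow> real sym" where
  "FS \<nu> = symstar_to_sym (shifted_schur \<nu>)"

text \<open>The image of \<open>FS \<nu>\<close> in the complexification of \<open>Sym\<close>.\<close>

definition FSC :: "diagram \<Rightarrow> complex sym" where
  "FSC \<nu> = Poly_Mapping.map complex_of_real (FS \<nu>)"


section \<open>Meixner symmetric functions and the Meixner operator\<close>

definition meixner_function ::
  "complex \<Rightarrow> complex \<Rightarrow> complex \<Rightarrow> diagram \<Rightarrow> complex sym" where
  "meixner_function z z' \<xi> \<nu> =
     (\<Sum>\<mu> \<in> {\<mu> \<in> young. \<mu> \<subseteq> \<nu>}.
        scale ((- 1) ^ (card \<nu> - card \<mu>) * (\<xi> / (1 - \<xi>)) ^ (card \<nu> - card \<mu>)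
               * (of_nat (skew_dim \<nu> \<mu>) / fact (card \<nu> - card \<mu>))
               * skew_poch z \<nu> \<mu> * skew_poch z' \<nu> \<mu>)
          (FSC \<mu>))"

text \<open>Well defined since the \<open>FSC \<nu>\<close> form a basis.\<close>

definition meixner_operator ::
  "complex \<Rightarrow> complex \<Rightarrow> complex \<Rightarrow> complex sym \<Rightarrow> complex sym" where
  "meixner_operator z z' \<xi> =
     (THE D. Vector_Spaces.linear scale scale D \<and>
        (\<forall>\<nu> \<in> young. D (FSC \<nu>) =
            scale (- of_nat (card \<nu>)) (FSC \<nu>)
          + scale (\<xi> / (1 - \<xi>))
              (\<Sum>b \<in> removable \<nu>.
                 scale ((z + of_int (content b)) * (z' + of_int (content b)))
                   (FSC (\<nu> - {b})))))"

end

theory Submission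
  imports Defs "HOL-Library.Function_Algebras"
begin

text \<open>The Frobenius-Schur functions form a basis of \<open>Sym\<close>, so the Meixner operator is well defined, and
  applying it to \<open>\<MM>\<^sub>\<nu>\<close> reduces the claim to a recursion for the coefficients. At \<open>FS\<^sub>\<kappa>\<close>
  the eigenvalue equation collects the contributions of all \<open>\<mu> = \<kappa> \<union> {b}\<close> inside \<open>\<nu>\<close>. The factors
  \<open>(z + c(b)) (z' + c(b))\<close> complete the products over \<open>\<nu>/\<mu>\<close> to those over \<open>\<nu>/\<kappa>\<close>, and what remains is
  \<open>dim \<nu>/\<kappa> = \<Sum>\<^sub>b dim \<nu>/(\<kappa> \<union> {b})\<close>, which holds because a standard tableau is determined by the box
  with entry 1 and the rest (\<open>skew_dim_recursion\<close>, \<open>meixner_coeff_recursion\<close>). The Meixner function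
  is nonzero since its coefficient at \<open>FS\<^sub>\<nu>\<close> is 1.

  The basis property rests on three facts.

  \<^item> The \<open>p\<^sup>*\<^sub>k\<close> are algebraically independent (\<open>pstar_independent\<close>), by the Jacobian criterion: the
    Jacobian of power sums is a Vandermonde matrix up to constants.

  \<^item> A monomial of weight \<open>n\<close> in the \<open>p\<^sup>*\<^sub>k\<close> is a combination of the \<open>S\<^sup>*\<^sub>\<mu>\<close> with \<open>|\<mu>| \<le> n\<close>, with
    coefficients independent of the number of variables (\<open>pstar_mult_schur_span\<close>,
    \<open>symstar_of_monomial\<close>). Indeed, multiplying a determinant of falling powers of the \<open>x\<^sub>j\<close>, with
    exponents \<open>l\<^sub>i\<close> in the rows, by a power sum raises one exponent \<open>l\<^sub>i\<close> at a time, and interchanging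
    rows turns every resulting determinant into 0 or, up to sign, the numerator of a shifted Schur
    polynomial.

  \<^item> There are at least as many monomials of weight at most \<open>n\<close> as diagrams of size at most \<open>n\<close>
    (\<open>card_young_le_card_weight\<close>).

  Hence an independent family lies in the span of a family that is no larger, so both span the same
  space and the \<open>S\<^sup>*\<^sub>\<mu>\<close> are independent as well. In particular, linear independence of the shifted Schur
  functions needs no separate proof.\<close>

section \<open>Evaluation of polynomials\<close>

text \<open>The value of a polynomial with coefficients mapped by \<open>h\<close> and variables by \<open>g\<close>. Substitution
  is the case \<open>h = Const\<close>; numerical evaluation is the case where \<open>h\<close> is the identity. It is a ring
  homomorphism whenever \<open>h\<close> is one.\<close>

definition pev :: "('a::zero \<Rightarrow> 'b::comm_ring_1) \<Rightarrow> (nat \<Rightarrow> 'b) \<Rightarrow> 'a mpol \<Rightarrow> 'b" where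
  "pev h g f = (\<Sum>m \<in> Poly_Mapping.keys f. h (Poly_Mapping.lookup f m) *
     (\<Prod>i \<in> Poly_Mapping.keys m. g i ^ Poly_Mapping.lookup m i))"

lemma subst_eq_pev: "subst g = pev Const g"
  by (simp add: fun_eq_iff subst_def pev_def scale_def)

lemma monomial_value_superset:
  fixes g :: "nat \<Rightarrow> 'b::comm_ring_1"
  assumes "finite I" "Poly_Mapping.keys m \<subseteq> I"
  shows "(\<Prod>i \<in> Poly_Mapping.keys m. g i ^ Poly_Mapping.lookup m i)
       = (\<Prod>i \<in> I. g i ^ Poly_Mapping.lookup m i)"
  using assms by (intro prod.mono_neutral_left) (auto simp: in_keys_iff)

lemma monomial_value_add:
  fixes g :: "nat \<Rightarrow> 'b::comm_ring_1"
  shows "(\<Prod>i \<in> Poly_Mapping.keys (m + m'). g i ^ Poly_Mapping.lookup (m + m') i)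
       = (\<Prod>i \<in> Poly_Mapping.keys m. g i ^ Poly_Mapping.lookup m i)
       * (\<Prod>i \<in> Poly_Mapping.keys m'. g i ^ Poly_Mapping.lookup m' i)"
proof -
  let ?I = "Poly_Mapping.keys m \<union> Poly_Mapping.keys m'"
  have "Poly_Mapping.keys (m + m') \<subseteq> ?I" by (rule keys_add)
  from monomial_value_superset[OF _ this, of g] show ?thesis
    by (simp add: monomial_value_superset[of ?I m] monomial_value_superset[of ?I m']
        lookup_add power_add prod.distrib)
qed

lemma sum_single_keys:
  fixes f :: "'a::comm_ring_1 mpol"
  shows "f = (\<Sum>m\<in>Poly_Mapping.keys f. Poly_Mapping.single m (Poly_Mapping.lookup f m))"
proof (rule poly_mapping_eqI)
  fix k
  have "(\<Sum>m\<in>Poly_Mapping.keys f. Poly_Mapping.lookup (Poly_Mapping.single m (Poly_Mapping.lookup f m)) k)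
      = (\<Sum>m\<in>Poly_Mapping.keys f. if m = k then Poly_Mapping.lookup f k else 0)"
    by (intro sum.cong) (auto simp: lookup_single when_def)
  also have "\<dots> = Poly_Mapping.lookup f k"
    by (auto simp: in_keys_iff)
  finally show "Poly_Mapping.lookup f k = Poly_Mapping.lookup
      (\<Sum>m\<in>Poly_Mapping.keys f. Poly_Mapping.single m (Poly_Mapping.lookup f m)) k"
    by (simp add: lookup_sum)
qed

context
  fixes h :: "'a::comm_ring_1 \<Rightarrow> 'b::comm_ring_1" and g :: "nat \<Rightarrow> 'b"
  assumes h: "comm_ring_hom h"
begin

interpretation h: comm_ring_hom h by (rule h)

lemma pev_superset:
  assumes "finite I" "Poly_Mapping.keys f \<subseteq> I"
  shows "pev h g f = (\<Sum>m \<in> I. h (Poly_Mapping.lookup f m) *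
     (\<Prod>i \<in> Poly_Mapping.keys m. g i ^ Poly_Mapping.lookup m i))"
  unfolding pev_def using assms by (intro sum.mono_neutral_left) (auto simp: in_keys_iff)

lemma pev_add: "pev h g (f + f') = pev h g f + pev h g f'"
proof -
  let ?I = "Poly_Mapping.keys f \<union> Poly_Mapping.keys f'"
  have "Poly_Mapping.keys (f + f') \<subseteq> ?I" by (rule keys_add)
  from pev_superset[OF _ this] show ?thesis
    by (simp add: pev_superset[of ?I f] pev_superset[of ?I f']
        lookup_add h.hom_add distrib_right sum.distrib)
qed

lemma pev_zero: "pev h g 0 = 0"
  by (simp add: pev_def)

lemma pev_sum: "pev h g (\<Sum>i\<in>I. f i) = (\<Sum>i\<in>I. pev h g (f i))"
  by (induction I rule: infinite_finite_induct) (simp_all add: pev_zero pev_add)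

lemma pev_single:
  "pev h g (Poly_Mapping.single m c) =
     h c * (\<Prod>i \<in> Poly_Mapping.keys m. g i ^ Poly_Mapping.lookup m i)"
  by (cases "c = 0") (simp_all add: pev_def)

lemma pev_mult: "pev h g (f * f') = pev h g f * pev h g f'"
proof -
  let ?s = "\<lambda>f m. Poly_Mapping.single m (Poly_Mapping.lookup f m) :: 'a mpol"
  have "f * f' = (\<Sum>m\<in>Poly_Mapping.keys f. ?s f m) * (\<Sum>m\<in>Poly_Mapping.keys f'. ?s f' m)"
    by (simp flip: sum_single_keys)
  also have "pev h g \<dots> = (\<Sum>m\<in>Poly_Mapping.keys f. \<Sum>m'\<in>Poly_Mapping.keys f'.
      pev h g (?s f m) * pev h g (?s f' m'))"
    by (simp add: sum_product pev_sum mult_single pev_single monomial_value_add h.hom_mult mult_ac)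
  also have "\<dots> = pev h g (\<Sum>m\<in>Poly_Mapping.keys f. ?s f m) * pev h g (\<Sum>m\<in>Poly_Mapping.keys f'. ?s f' m)"
    by (simp add: sum_product pev_sum)
  finally show ?thesis by (simp flip: sum_single_keys)
qed

lemma pev_one: "pev h g 1 = 1"
  by (simp add: pev_single flip: single_one)

lemma comm_ring_hom_pev: "comm_ring_hom (pev h g)"
  by unfold_locales (simp_all add: pev_zero pev_add pev_mult pev_one)

lemma pev_Var: "pev h g (Var i) = g i"
  by (simp add: Var_def pev_single)

lemma pev_Const: "pev h g (Const c) = h c"
  by (simp add: Const_def pev_single)

end

lemma comm_ring_hom_Const: "comm_ring_hom (Const :: 'a::comm_ring_1 \<Rightarrow> 'a mpol)"
  by unfold_locales (simp_all add: Const_def single_add mult_single)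

interpretation Const: comm_ring_hom "Const :: 'a::comm_ring_1 \<Rightarrow> 'a mpol"
  by (rule comm_ring_hom_Const)

lemma comm_ring_hom_subst: "comm_ring_hom (subst g)"
  unfolding subst_eq_pev by (rule comm_ring_hom_pev[OF comm_ring_hom_Const])

interpretation subst: comm_ring_hom "subst g" for g :: "nat \<Rightarrow> 'a::comm_ring_1 mpol"
  by (rule comm_ring_hom_subst)

lemma subst_Var [simp]: "subst g (Var i) = g i"
  by (simp add: subst_eq_pev pev_Var[OF comm_ring_hom_Const])

lemma subst_Const [simp]: "subst g (Const c) = Const c"
  by (simp add: subst_eq_pev pev_Const[OF comm_ring_hom_Const])

lemma subst_scale: "subst g (scale c f) = scale c (subst g f)"
  by (simp add: scale_def subst.hom_mult)

lemma comm_ring_hom_id: "comm_ring_hom (\<lambda>x::'a::comm_ring_1. x)"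
  by unfold_locales simp_all

lemma pev_subst:
  fixes f :: "'a::comm_ring_1 mpol"
  shows "pev (\<lambda>x. x) v (subst g f) = pev (\<lambda>x. x) (\<lambda>i. pev (\<lambda>x. x) v (g i)) f"
proof -
  interpret e: comm_ring_hom "pev (\<lambda>x::'a. x) v" by (rule comm_ring_hom_pev[OF comm_ring_hom_id])
  show ?thesis
    by (simp add: subst_eq_pev pev_def[of Const] pev_def[of _ "\<lambda>i. pev _ v (g i)"] e.hom_sum e.hom_mult
        e.hom_prod e.hom_power pev_Const[OF comm_ring_hom_id])
qed

lemma lookup_scale: "Poly_Mapping.lookup (scale c f) m = c * Poly_Mapping.lookup f m"
proof -
  have "scale c f = Poly_Mapping.map ((*) c) f"
    by (simp add: scale_def Const_def mult_map_scale_conv_mult)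
  then show ?thesis by (simp add: Poly_Mapping.map.rep_eq when_def)
qed

lemma vector_space_scale: "vector_space (scale :: 'a::field \<Rightarrow> 'a mpol \<Rightarrow> 'a mpol)"
  by unfold_locales (simp_all add: scale_def algebra_simps Const.hom_add Const.hom_mult)

section \<open>Bases from spanning families\<close>

text \<open>A family of at most \<open>card S\<close> vectors that spans an independent set \<open>S\<close> has no repetitions, is
  independent, and lies in the span of \<open>S\<close>.\<close>

lemma (in vector_space) spanning_family_is_basis:
  assumes "finite B" "independent S" "card B \<le> card S" "S \<subseteq> span (f ` B)"
  shows "inj_on f B" "independent (f ` B)" "f ` B \<subseteq> span S"
proof -
  have fin: "finite (f ` B)" using assms(1) by simp
  have S: "finite S" "card S \<le> card (f ` B)"
    using independent_span_bound[OF fin assms(2,4)] by auto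
  have card: "card (f ` B) = card B"
    using S assms(1,3) card_image_le[of B f] by linarith
  then show "inj_on f B" using assms(1) by (intro eq_card_imp_inj_on)
  show "independent (f ` B)"
  proof
    assume "dependent (f ` B)"
    then obtain t where t: "t \<in> f ` B" "t \<in> span (f ` B - {t})" by (auto simp: dependent_def)
    then have "span (f ` B - {t}) = span (f ` B)"
      using span_redundant[OF t(2)] by (simp add: insert_absorb)
    then have "card S \<le> card (f ` B - {t})"
      using independent_span_bound[of "f ` B - {t}" S] fin assms by auto
    moreover have "card (f ` B - {t}) < card (f ` B)"
      using t(1) fin by (intro card_Diff1_less)
    ultimately show False using card assms(3) by linarith
  qed
  show "f ` B \<subseteq> span S"
  proof
    fix t assume t: "t \<in> f ` B"
    show "t \<in> span S"
    proof (rule ccontr)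
      assume nt: "t \<notin> span S"
      then have "independent (insert t S)" using assms(2) by (simp add: independent_insert)
      then have "card (insert t S) \<le> card (f ` B)"
        using independent_span_bound[OF fin, of "insert t S"] assms(4) t by (auto intro: span_base)
      moreover have "t \<notin> S" using nt span_base by auto
      ultimately show False using S card assms(3) by simp
    qed
  qed
qed

section \<open>Alternants of falling factorials\<close>

text \<open>The determinant of the falling factorials of \<open>x\<^sub>j\<close> with exponents \<open>\<alpha>\<^sub>i + N - 1 - i\<close>, for any
  function \<open>\<alpha>\<close>, not only for the row lengths of a diagram. Intermediate terms of the multiplication
  rule below are of this kind with \<open>\<alpha>\<close> not decreasing.\<close>

definition alternant :: "(nat \<Rightarrow> 'a::comm_ring_1) \<Rightarrow> (nat \<Rightarrow> nat) \<Rightarrow> nat \<Rightarrow> 'a" where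
  "alternant x \<alpha> N = det (mat N N (\<lambda>(i, j). falling (x j) (\<alpha> i + N - 1 - i)))"

definition difference_product :: "(nat \<Rightarrow> 'a::comm_ring_1) \<Rightarrow> nat \<Rightarrow> 'a" where
  "difference_product x N = (\<Prod>j<N. \<Prod>t\<in>{j<..<N}. x j - x t)"

lemma vandermonde_eq: "vandermonde N = difference_product Var N"
proof -
  have "{(i, j). i < j \<and> j < N} = (SIGMA j:{..<N}. {j<..<N})" by auto
  then show ?thesis
    by (simp add: vandermonde_def difference_product_def prod.Sigma)
qed

text \<open>The divided difference \<open>f[a\<^sub>0, \<dots>, a\<^sub>k]\<close>, defined by repeated synthetic division, so that no
  difference of nodes has to be inverted.\<close>

primrec divdiff :: "'a::comm_ring_1 poly \<Rightarrow> (nat \<Rightarrow> 'a) \<Rightarrow> nat \<Rightarrow> 'a" where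
  "divdiff f a 0 = poly f (a 0)"
| "divdiff f a (Suc k) = divdiff (synthetic_div f (a 0)) (\<lambda>t. a (Suc t)) k"

lemma newton_interpolation:
  "poly f (a j) = (\<Sum>k\<le>j. divdiff f a k * (\<Prod>t<k. a j - a t))"
proof (induction j arbitrary: f a)
  case 0
  then show ?case by simp
next
  case (Suc j)
  let ?q = "synthetic_div f (a 0)"
  have "poly f (a (Suc j)) = poly ([:- a 0, 1:] * ?q + [:poly f (a 0):]) (a (Suc j))"
    by (simp only: synthetic_div_correct')
  also have "\<dots> = poly f (a 0) + (a (Suc j) - a 0) * poly ?q (a (Suc j))"
    by (simp add: algebra_simps)
  also have "poly ?q (a (Suc j)) = (\<Sum>k\<le>j. divdiff ?q (\<lambda>t. a (Suc t)) k * (\<Prod>t<k. a (Suc j) - a (Suc t)))"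
    using Suc.IH[of ?q "\<lambda>t. a (Suc t)"] .
  finally show ?case
    by (simp add: sum.atMost_Suc_shift prod.lessThan_Suc_shift sum_distrib_left mult_ac
        del: sum.atMost_Suc prod.lessThan_Suc)
qed

lemma coeff_synthetic_div:
  assumes "degree f \<le> Suc d"
  shows "coeff (synthetic_div f c) d = coeff f (Suc d)"
proof -
  let ?q = "synthetic_div f c"
  have "coeff ?q (Suc d) = 0"
    using assms by (intro coeff_eq_0) (auto simp: degree_synthetic_div)
  moreover have "coeff (f + smult c ?q) (Suc d) = coeff (pCons (poly f c) ?q) (Suc d)"
    by (simp only: synthetic_div_correct)
  ultimately show ?thesis by simp
qed

lemma divdiff_degree:
  assumes "degree f \<le> d"
  shows "d < k \<Longrightarrow> divdiff f a k = 0" "divdiff f a d = coeff f d"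
proof -
  have "(d < k \<longrightarrow> divdiff f a k = 0) \<and> divdiff f a d = coeff f d" for k
    using assms
  proof (induction d arbitrary: f a k)
    case 0
    then obtain c where "f = [:c:]" by (auto elim: degree_eq_zeroE)
    moreover have "divdiff 0 a k = 0" for a :: "nat \<Rightarrow> 'a" and k
      by (induction k arbitrary: a) simp_all
    ultimately show ?case by (cases k) simp_all
  next
    case (Suc d)
    then have "degree (synthetic_div f (a 0)) \<le> d" by (simp add: degree_synthetic_div)
    note IH = Suc.IH[OF this, of _ "\<lambda>t. a (Suc t)"]
    show ?case
      using IH[of "k - 1"] Suc.prems by (cases k) (auto simp: coeff_synthetic_div)
  qed
  then show "d < k \<Longrightarrow> divdiff f a k = 0" "divdiff f a d = coeff f d" by blast+
qed

text \<open>Newton interpolation at the nodes \<open>x\<^sub>N\<^sub>-\<^sub>1, \<dots>, x\<^sub>0\<close> writes the matrix \<open>[f\<^sub>i(x\<^sub>j)]\<close> as a matrix of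
  divided differences times a lower triangular matrix. Taking the nodes in decreasing order makes
  the diagonal entries of the latter \<open>\<Prod>\<^sub>t\<^sub>>\<^sub>j (x\<^sub>j - x\<^sub>t)\<close>, hence its determinant the Vandermonde product
  without any sign.\<close>

lemma det_poly_factor:
  fixes x :: "nat \<Rightarrow> 'a::comm_ring_1"
  shows "det (mat N N (\<lambda>(i, j). poly (f i) (x j)))
    = det (mat N N (\<lambda>(i, k). divdiff (f i) (\<lambda>t. x (N - 1 - t)) (N - 1 - k)))
      * difference_product x N"
proof -
  let ?a = "\<lambda>t. x (N - 1 - t)"
  let ?F = "mat N N (\<lambda>(i, k). divdiff (f i) ?a (N - 1 - k))"
  let ?U = "mat N N (\<lambda>(k, j). \<Prod>t\<in>{k<..<N}. x j - x t)"
  have "mat N N (\<lambda>(i, j). poly (f i) (x j)) = ?F * ?U"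
  proof (rule eq_matI)
    fix i j assume "i < dim_row (?F * ?U)" "j < dim_col (?F * ?U)"
    then have ij: "i < N" "j < N" by simp_all
    have "poly (f i) (x j) = poly (f i) (?a (N - 1 - j))" using ij by simp
    also have "\<dots> = (\<Sum>k\<le>N - 1 - j. divdiff (f i) ?a k * (\<Prod>t<k. x j - ?a t))"
      using newton_interpolation[of "f i" ?a "N - 1 - j"] ij by simp
    also have "\<dots> = (\<Sum>k\<in>{j..<N}. divdiff (f i) ?a (N - 1 - k) * (\<Prod>t<N - 1 - k. x j - ?a t))"
      using ij by (intro sum.reindex_bij_witness[of _ "\<lambda>k. N - 1 - k" "\<lambda>k. N - 1 - k"]) auto
    also have "\<dots> = (\<Sum>k\<in>{j..<N}. divdiff (f i) ?a (N - 1 - k) * (\<Prod>t\<in>{k<..<N}. x j - x t))"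
      by (intro sum.cong refl arg_cong2[where f = "(*)"]
          prod.reindex_bij_witness[of _ "\<lambda>t. N - 1 - t" "\<lambda>t. N - 1 - t"]) auto
    also have "\<dots> = (\<Sum>k\<in>{0..<N}. divdiff (f i) ?a (N - 1 - k) * (\<Prod>t\<in>{k<..<N}. x j - x t))"
    proof (intro sum.mono_neutral_left ballI)
      fix k assume "k \<in> {0..<N} - {j..<N}"
      then have "(\<Prod>t\<in>{k<..<N}. x j - x t) = 0"
        using ij by (intro prod_zero bexI[of _ j]) auto
      then show "divdiff (f i) ?a (N - 1 - k) * (\<Prod>t\<in>{k<..<N}. x j - x t) = 0" by simp
    qed auto
    also have "\<dots> = (?F * ?U) $$ (i, j)"
      using ij by (simp add: scalar_prod_def)
    finally show "mat N N (\<lambda>(i, j). poly (f i) (x j)) $$ (i, j) = (?F * ?U) $$ (i, j)"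
      using ij by simp
  qed simp_all
  moreover have "det ?U = difference_product x N"
  proof -
    have "det ?U = prod_list (diag_mat ?U)"
    proof (rule det_lower_triangular[of N])
      fix k j assume "k < j" "j < N"
      then show "?U $$ (k, j) = 0" by (auto intro!: prod_zero)
    qed simp
    also have "\<dots> = difference_product x N"
      by (simp add: prod_list_diag_prod difference_product_def atLeast0LessThan)
    finally show ?thesis .
  qed
  ultimately show ?thesis by (simp add: det_mult[of _ N])
qed

definition falling_poly :: "nat \<Rightarrow> 'a::comm_ring_1 poly" where
  "falling_poly n = (\<Prod>k<n. [:- of_nat k, 1:])"

lemma poly_falling_poly: "poly (falling_poly n) x = falling x n"
  by (simp add: falling_poly_def falling_def poly_prod)

lemma degree_falling_poly: "degree (falling_poly n :: 'a::comm_ring_1 poly) \<le> n"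
    and coeff_falling_poly: "coeff (falling_poly n :: 'a poly) n = 1"
proof -
  have "degree (falling_poly n :: 'a poly) \<le> n \<and> coeff (falling_poly n :: 'a poly) n = 1"
  proof (induction n)
    case 0
    then show ?case by (simp add: falling_poly_def)
  next
    case (Suc n)
    let ?p = "falling_poly n :: 'a poly"
    have eq: "falling_poly (Suc n) = pCons 0 ?p - smult (of_nat n) ?p"
      by (simp add: falling_poly_def algebra_simps)
    have "degree (falling_poly (Suc n) :: 'a poly) \<le> Suc n"
      unfolding eq using Suc by (intro degree_diff_le degree_pCons_le[THEN order_trans]
          degree_smult_le[THEN order_trans]) auto
    moreover have "coeff ?p (Suc n) = 0" using Suc by (intro coeff_eq_0) auto
    ultimately show ?case using Suc by (simp add: eq)
  qed
  then show "degree (falling_poly n :: 'a::comm_ring_1 poly) \<le> n"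
    "coeff (falling_poly n :: 'a poly) n = 1" by auto
qed

lemma difference_product_dvd_alternant: "difference_product x N dvd alternant x \<alpha> N"
  using det_poly_factor[of N "\<lambda>i. falling_poly (\<alpha> i + N - 1 - i)" x]
  by (simp add: alternant_def poly_falling_poly)

lemma alternant_zero: "alternant x (\<lambda>_. 0) N = difference_product x N"
proof -
  let ?F = "mat N N (\<lambda>(i, k). divdiff (falling_poly (N - 1 - i)) (\<lambda>t. x (N - 1 - t)) (N - 1 - k))"
  have "det ?F = prod_list (diag_mat ?F)"
  proof (rule det_upper_triangular[of _ N], rule upper_triangularI)
    fix i j assume "j < i" "i < dim_row ?F"
    then show "?F $$ (i, j) = 0"
      using degree_falling_poly[of "N - 1 - i", where 'a = 'a]
      by (auto intro!: divdiff_degree(1))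
  qed simp
  also have "\<dots> = 1"
    unfolding prod_list_diag_prod
    by (rule prod.neutral)
       (use divdiff_degree(2)[OF degree_falling_poly, where 'a = 'a] coeff_falling_poly[where 'a = 'a] in auto)
  finally show ?thesis
    using det_poly_factor[of N "\<lambda>i. falling_poly (N - 1 - i)" x]
    by (simp add: alternant_def poly_falling_poly)
qed

text \<open>Leibniz's formula: every permutation picks each column exactly once, so a factor
  \<open>\<Sum>\<^sub>j q\<^sub>j\<close> can be distributed over the rows.\<close>

lemma sum_mult_det:
  fixes q :: "nat \<Rightarrow> 'a::comm_ring_1"
  shows "(\<Sum>j<N. q j) * det (mat N N (\<lambda>(i, j). A i j))
    = (\<Sum>i<N. det (mat N N (\<lambda>(i', j). if i' = i then q j * A i j else A i' j)))"
proof -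
  let ?P = "{p. p permutes {0..<N}}"
  have row: "(\<Prod>i'<N. if i' = i then q (p i') * A i (p i') else A i' (p i')) = q (p i) * (\<Prod>i'<N. A i' (p i'))"
    if "i < N" for i p
    using that by (simp add: prod.remove[of _ i])
  have "(\<Sum>i<N. det (mat N N (\<lambda>(i', j). if i' = i then q j * A i j else A i' j)))
      = (\<Sum>i<N. \<Sum>p\<in>?P. signof p * (\<Prod>i'<N. if i' = i then q (p i') * A i (p i') else A i' (p i')))"
    by (intro sum.cong refl, subst det_def'[of _ N])
       (auto simp: atLeast0LessThan permutes_in_image intro!: sum.cong prod.cong)
  also have "\<dots> = (\<Sum>i<N. \<Sum>p\<in>?P. signof p * (q (p i) * (\<Prod>i'<N. A i' (p i'))))"
    by (intro sum.cong refl) (simp add: row)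
  also have "\<dots> = (\<Sum>p\<in>?P. (\<Sum>i<N. q (p i)) * (signof p * (\<Prod>i'<N. A i' (p i'))))"
    by (subst sum.swap) (simp add: sum_distrib_left sum_distrib_right mult_ac)
  also have "\<dots> = (\<Sum>p\<in>?P. (\<Sum>j<N. q j) * (signof p * (\<Prod>i'<N. A i' (p i'))))"
  proof (intro sum.cong refl)
    fix p assume "p \<in> ?P"
    then have "bij_betw p {..<N} {..<N}" by (auto simp: permutes_imp_bij atLeast0LessThan)
    then have "(\<Sum>i<N. q (p i)) = (\<Sum>j<N. q j)" by (rule sum.reindex_bij_betw)
    then show "(\<Sum>i<N. q (p i)) * (signof p * (\<Prod>i'<N. A i' (p i')))
      = (\<Sum>j<N. q j) * (signof p * (\<Prod>i'<N. A i' (p i')))" by simp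
  qed
  also have "\<dots> = (\<Sum>j<N. q j) * det (mat N N (\<lambda>(i, j). A i j))"
    by (subst det_def'[of _ N])
       (auto simp: sum_distrib_left atLeast0LessThan permutes_in_image intro!: sum.cong prod.cong)
  finally show ?thesis ..
qed

lemma det_row_linear:
  fixes c :: "'r \<Rightarrow> 'a::comm_ring_1"
  assumes "i < N"
  shows "det (mat N N (\<lambda>(i', j). if i' = i then (\<Sum>r\<in>R. c r * B r j) else A i' j))
    = (\<Sum>r\<in>R. c r * det (mat N N (\<lambda>(i', j). if i' = i then B r j else A i' j)))"
proof -
  let ?P = "{p. p permutes {0..<N}}"
  have det: "det (mat N N (\<lambda>(i', j). if i' = i then b j else A i' j))
     = (\<Sum>p\<in>?P. signof p * (b (p i) * (\<Prod>i'\<in>{..<N} - {i}. A i' (p i'))))" for b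
  proof -
    have row: "(\<Prod>i'<N. if i' = i then b (p i') else A i' (p i')) = b (p i) * (\<Prod>i'\<in>{..<N} - {i}. A i' (p i'))"
      for p using assms by (simp add: prod.remove[of _ i])
    then show ?thesis
      by (subst det_def'[of _ N])
         (auto simp: atLeast0LessThan permutes_in_image simp flip: row intro!: sum.cong prod.cong)
  qed
  show ?thesis
    unfolding det
    by (simp add: sum_distrib_left sum_distrib_right mult_ac) (subst sum.swap, simp)
qed

text \<open>The coefficients of \<open>(x + u)^k\<close> times a falling factorial in the basis of falling factorials,
  with \<open>a = l + u\<close> for the exponent \<open>l\<close>; they come from
  \<open>(x + u) x\<^sup>\<down>\<^sup>l = x\<^sup>\<down>\<^sup>(\<^sup>l\<^sup>+\<^sup>1\<^sup>) + (l + u) x\<^sup>\<down>\<^sup>l\<close>.\<close>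

fun step_coeff :: "nat \<Rightarrow> nat \<Rightarrow> 'a::comm_ring_1 \<Rightarrow> 'a" where
  "step_coeff 0 r a = (if r = 0 then 1 else 0)"
| "step_coeff (Suc k) r a =
     (if r = 0 then 0 else step_coeff k (r - 1) a) + (a + of_nat r) * step_coeff k r a"

lemma step_coeff_0: "step_coeff k 0 a = a ^ k"
  by (induction k) simp_all

lemma step_coeff_gt: "k < r \<Longrightarrow> step_coeff k r a = 0"
  by (induction k arbitrary: r) simp_all

lemma falling_Suc: "falling x (Suc l) = falling x l * (x - of_nat l)"
  by (simp add: falling_def)

lemma power_mult_falling:
  fixes x u :: "'a::comm_ring_1"
  shows "(x + u) ^ k * falling x l = (\<Sum>r\<le>k. step_coeff k r (of_nat l + u) * falling x (l + r))"
proof (induction k)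
  case 0
  then show ?case by simp
next
  case (Suc k)
  let ?a = "of_nat l + u"
  have step: "(x + u) * falling x (l + r) = falling x (l + Suc r) + (?a + of_nat r) * falling x (l + r)" for r
    by (simp add: falling_Suc algebra_simps)
  have "(x + u) ^ Suc k * falling x l = (x + u) * ((x + u) ^ k * falling x l)"
    by (simp add: mult_ac)
  also have "\<dots> = (\<Sum>r\<le>k. step_coeff k r ?a * ((x + u) * falling x (l + r)))"
    unfolding Suc by (simp add: sum_distrib_left mult_ac)
  also have "\<dots> = (\<Sum>r\<le>k. step_coeff k r ?a * falling x (l + Suc r)
      + (?a + of_nat r) * step_coeff k r ?a * falling x (l + r))"
    by (intro sum.cong refl) (simp add: step distrib_left mult.assoc mult.left_commute)
  also have "\<dots> = (\<Sum>r\<le>k. step_coeff k r ?a * falling x (l + Suc r))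
      + (\<Sum>r\<le>k. (?a + of_nat r) * step_coeff k r ?a * falling x (l + r))"
    by (rule sum.distrib)
  also have "(\<Sum>r\<le>k. step_coeff k r ?a * falling x (l + Suc r))
      = (\<Sum>r\<le>Suc k. (if r = 0 then 0 else step_coeff k (r - 1) ?a) * falling x (l + r))"
    by (simp add: sum.atMost_Suc_shift del: sum.atMost_Suc)
  also have "(\<Sum>r\<le>k. (?a + of_nat r) * step_coeff k r ?a * falling x (l + r))
      = (\<Sum>r\<le>Suc k. (?a + of_nat r) * step_coeff k r ?a * falling x (l + r))"
    by (simp add: step_coeff_gt)
  finally show ?case
    by (simp add: sum.distrib[symmetric] distrib_right[symmetric] del: sum.atMost_Suc)
qed

lemma power_sum_mult_alternant:
  fixes x :: "nat \<Rightarrow> 'a::comm_ring_1"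
  shows "(\<Sum>j<N. (x j + u) ^ k) * alternant x \<alpha> N
    = (\<Sum>i<N. \<Sum>r\<le>k. step_coeff k r (of_nat (\<alpha> i + N - 1 - i) + u) * alternant x (\<alpha>(i := \<alpha> i + r)) N)"
proof -
  have "(\<Sum>j<N. (x j + u) ^ k) * alternant x \<alpha> N
    = (\<Sum>i<N. det (mat N N (\<lambda>(i', j). if i' = i then
         (\<Sum>r\<le>k. step_coeff k r (of_nat (\<alpha> i + N - 1 - i) + u) * falling (x j) (\<alpha> i + N - 1 - i + r))
         else falling (x j) (\<alpha> i' + N - 1 - i'))))"
    unfolding alternant_def sum_mult_det power_mult_falling ..
  also have "\<dots> = (\<Sum>i<N. \<Sum>r\<le>k. step_coeff k r (of_nat (\<alpha> i + N - 1 - i) + u) *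
      det (mat N N (\<lambda>(i', j). if i' = i then falling (x j) (\<alpha> i + N - 1 - i + r)
         else falling (x j) (\<alpha> i' + N - 1 - i'))))"
    by (intro sum.cong refl det_row_linear) simp
  also have "\<dots> = (\<Sum>i<N. \<Sum>r\<le>k. step_coeff k r (of_nat (\<alpha> i + N - 1 - i) + u) *
      alternant x (\<alpha>(i := \<alpha> i + r)) N)"
    unfolding alternant_def
    by (intro sum.cong refl arg_cong2[where f = "(*)"] arg_cong[where f = det] eq_matI)
       (auto intro!: arg_cong[where f = "falling _"])
  finally show ?thesis .
qed

text \<open>The new exponents are those of \<open>\<alpha>\<close> with rows \<open>i\<close> and \<open>i + 1\<close> interchanged: the two rows differ
  by one in the shift \<open>N - 1 - i\<close>.\<close>

lemma alternant_swap:
  assumes "Suc i < N" "0 < \<alpha> (Suc i)"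
  shows "alternant x (\<alpha>(i := \<alpha> (Suc i) - 1, Suc i := \<alpha> i + 1)) N = - alternant x \<alpha> N"
proof -
  let ?A = "mat N N (\<lambda>(i, j). falling (x j) (\<alpha> i + N - 1 - i))"
  have "mat N N (\<lambda>(i', j). falling (x j) ((\<alpha>(i := \<alpha> (Suc i) - 1, Suc i := \<alpha> i + 1)) i' + N - 1 - i'))
     = swaprows i (Suc i) ?A"
  proof (rule eq_matI)
    fix i' j assume "i' < dim_row (swaprows i (Suc i) ?A)" "j < dim_col (swaprows i (Suc i) ?A)"
    moreover have "\<alpha> (Suc i) - Suc 0 + N - Suc i = \<alpha> (Suc i) + N - Suc (Suc i)"
      "Suc (\<alpha> i + N) - Suc (Suc i) = \<alpha> i + N - Suc i" using assms by linarith+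
    ultimately show "mat N N (\<lambda>(i', j). falling (x j) ((\<alpha>(i := \<alpha> (Suc i) - 1, Suc i := \<alpha> i + 1)) i' + N - 1 - i')) $$ (i', j)
      = swaprows i (Suc i) ?A $$ (i', j)"
      using assms by auto
  qed simp_all
  then show ?thesis
    unfolding alternant_def using assms by (subst det_swaprows[of i N "Suc i" ?A, symmetric]) auto
qed

lemma alternant_equal_exponents:
  assumes "i < i'" "i' < N" "\<alpha> i' + i = \<alpha> i + i'"
  shows "alternant x \<alpha> N = 0"
  unfolding alternant_def
proof (rule det_identical_rows[of _ N i i'])
  let ?A = "mat N N (\<lambda>(i, j). falling (x j) (\<alpha> i + N - 1 - i))"
  have "\<alpha> i + N - 1 - i = \<alpha> i' + N - 1 - i'" using assms by linarith
  then show "row ?A i = row ?A i'"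
    using assms by (intro eq_vecI) auto
qed (use assms in auto)

lemma alternant_hom:
  assumes "comm_ring_hom h"
  shows "h (alternant x \<alpha> N) = alternant (\<lambda>j. h (x j)) \<alpha> N"
proof -
  interpret comm_ring_hom h by (rule assms)
  have "h (falling y n) = falling (h y) n" for y n
    by (simp add: falling_def hom_prod hom_minus hom_of_nat)
  then have "map_mat h (mat N N (\<lambda>(i, j). falling (x j) (\<alpha> i + N - 1 - i)))
     = mat N N (\<lambda>(i, j). falling (h (x j)) (\<alpha> i + N - 1 - i))"
    by (intro eq_matI) auto
  then show ?thesis by (simp add: alternant_def flip: hom_det)
qed

lemma difference_product_hom:
  assumes "comm_ring_hom h"
  shows "h (difference_product x N) = difference_product (\<lambda>j. h (x j)) N"
proof -
  interpret comm_ring_hom h by (rule assms)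
  show ?thesis by (simp add: difference_product_def hom_prod hom_minus)
qed

section \<open>Young diagrams and their rows\<close>

lemma downward_closed_eq_lessThan:
  fixes S :: "nat set"
  assumes "finite S" "\<And>i j. j \<in> S \<Longrightarrow> i \<le> j \<Longrightarrow> i \<in> S"
  shows "S = {..<card S}"
proof -
  have "\<exists>n. S = {..<n}"
  proof (cases "S = {}")
    case False
    then have "Max S \<in> S" using assms(1) by simp
    then have "{..<Suc (Max S)} \<subseteq> S" using assms(2)[of "Max S"] by (auto simp: less_Suc_eq_le)
    moreover have "S \<subseteq> {..<Suc (Max S)}" using assms(1) by (auto simp: less_Suc_eq_le)
    ultimately have "S = {..<Suc (Max S)}" by blast
    then show ?thesis ..
  qed auto
  then show ?thesis by auto
qed

lemma youngD:
  assumes "\<nu> \<in> young"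
  shows "finite \<nu>" "(i, j) \<in> \<nu> \<Longrightarrow> i' \<le> i \<Longrightarrow> j' \<le> j \<Longrightarrow> (i', j') \<in> \<nu>"
  using assms by (auto simp: young_def)

lemma young_row:
  assumes "\<nu> \<in> young"
  shows "{j. (i, j) \<in> \<nu>} = {..<row_len \<nu> i}"
  unfolding row_len_def
proof (rule downward_closed_eq_lessThan)
  show "finite {j. (i, j) \<in> \<nu>}"
    using finite_imageI[OF youngD(1)[OF assms], of snd] by (rule finite_subset[rotated]) force
qed (use youngD(2)[OF assms] in blast)

lemma young_mem_iff: "\<nu> \<in> young \<Longrightarrow> (i, j) \<in> \<nu> \<longleftrightarrow> j < row_len \<nu> i"
  using young_row[of \<nu> i] by blast

lemma row_len_antimono:
  assumes "\<nu> \<in> young" "i \<le> i'"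
  shows "row_len \<nu> i' \<le> row_len \<nu> i"
proof (rule ccontr)
  assume "\<not> ?thesis"
  then have "(i', row_len \<nu> i) \<in> \<nu>" using assms by (simp add: young_mem_iff)
  then have "(i, row_len \<nu> i) \<in> \<nu>" using assms youngD(2) by blast
  then show False using assms by (simp add: young_mem_iff)
qed

lemma row_len_eq_0:
  assumes "\<nu> \<in> young" "card \<nu> \<le> i"
  shows "row_len \<nu> i = 0"
proof (rule ccontr)
  assume "row_len \<nu> i \<noteq> 0"
  then have "(i, 0) \<in> \<nu>" using assms by (simp add: young_mem_iff)
  then have "(\<lambda>i. (i, 0)) ` {..i} \<subseteq> \<nu>" using youngD(2)[OF assms(1)] by auto
  then have "card ((\<lambda>i. (i, 0::nat)) ` {..i}) \<le> card \<nu>"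
    using youngD(1)[OF assms(1)] by (intro card_mono)
  moreover have "card ((\<lambda>i. (i, 0::nat)) ` {..i}) = Suc i"
    by (subst card_image) (auto simp: inj_on_def)
  ultimately show False using assms(2) by linarith
qed

lemma card_young:
  assumes "\<nu> \<in> young" "\<And>i. L \<le> i \<Longrightarrow> row_len \<nu> i = 0"
  shows "card \<nu> = (\<Sum>i<L. row_len \<nu> i)"
proof -
  have "\<nu> = (SIGMA i:{..<L}. {..<row_len \<nu> i})"
    using assms(2) by (auto simp: young_mem_iff[OF assms(1)]) (metis less_nat_zero_code not_le)
  then have "card \<nu> = card (SIGMA i:{..<L}. {..<row_len \<nu> i})" by simp
  then show ?thesis by simp
qed

lemma num_rows_le_iff:
  assumes "\<nu> \<in> young"
  shows "num_rows \<nu> \<le> N \<longleftrightarrow> (\<forall>i\<ge>N. row_len \<nu> i = 0)"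
proof -
  have "{i. row_len \<nu> i \<noteq> 0} = {..<num_rows \<nu>}"
    unfolding num_rows_def
  proof (rule downward_closed_eq_lessThan)
    have "{i. row_len \<nu> i \<noteq> 0} \<subseteq> {..<card \<nu>}"
      using row_len_eq_0[OF assms] by (auto simp: not_le intro: ccontr)
    then show "finite {i. row_len \<nu> i \<noteq> 0}" by (rule finite_subset) simp
    show "i \<in> {i. row_len \<nu> i \<noteq> 0}" if "j \<in> {i. row_len \<nu> i \<noteq> 0}" "i \<le> j" for i j
      using that row_len_antimono[OF assms, of i j] by simp
  qed
  then have "row_len \<nu> i \<noteq> 0 \<longleftrightarrow> i < num_rows \<nu>" for i by blast
  then show ?thesis by (metis le_less_trans not_le order_refl)
qed

lemma diagram_of_rows:
  assumes "\<And>t. \<alpha> (Suc t) \<le> \<alpha> t" "\<And>t. L \<le> t \<Longrightarrow> \<alpha> t = 0"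
  shows "{(i, j). j < \<alpha> i} \<in> young" "row_len {(i, j). j < \<alpha> i} = \<alpha>"
    "card {(i, j). j < \<alpha> i} = (\<Sum>i<L. \<alpha> i)"
proof -
  have mono: "\<alpha> i' \<le> \<alpha> i" if "i \<le> i'" for i i'
    using lift_Suc_antimono_le[of \<alpha>, OF assms(1) that] .
  have eq: "{(i, j). j < \<alpha> i} = (SIGMA i:{..<L}. {..<\<alpha> i})"
    using assms(2) by auto (metis less_nat_zero_code not_le)
  then have "finite {(i, j). j < \<alpha> i}" by simp
  then show "{(i, j). j < \<alpha> i} \<in> young"
    using mono by (auto simp: young_def) (meson le_less_trans less_le_trans)
  show "row_len {(i, j). j < \<alpha> i} = \<alpha>" by (auto simp: row_len_def)
  show "card {(i, j). j < \<alpha> i} = (\<Sum>i<L. \<alpha> i)" unfolding eq by simp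
qed

lemma empty_young [simp]: "{} \<in> young"
  by (simp add: young_def)

lemma finite_young_card_le: "finite {\<nu> \<in> young. card \<nu> \<le> n}"
proof (rule finite_subset)
  show "{\<nu> \<in> young. card \<nu> \<le> n} \<subseteq> Pow ({..<n} \<times> {..<n})"
  proof
    fix \<nu> assume "\<nu> \<in> {\<nu> \<in> young. card \<nu> \<le> n}"
    then have \<nu>: "\<nu> \<in> young" "card \<nu> \<le> n" by auto
    have "i < n \<and> j < n" if "(i, j) \<in> \<nu>" for i j
    proof
      show "i < n"
        using row_len_eq_0[OF \<nu>(1), of i] \<nu> that by (cases "i < n") (auto simp: young_mem_iff)
      have "j < row_len \<nu> i" using that \<nu> by (simp add: young_mem_iff)
      also have "row_len \<nu> i \<le> card \<nu>"
        using card_young[OF \<nu>(1), of "max (card \<nu>) (Suc i)"] row_len_eq_0[OF \<nu>(1)]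
          member_le_sum[of i "{..<max (card \<nu>) (Suc i)}" "row_len \<nu>"] by simp
      finally show "j < n" using \<nu>(2) by simp
    qed
    then show "\<nu> \<in> Pow ({..<n} \<times> {..<n})" by auto
  qed
qed simp

section \<open>Shifted Schur polynomials as quotients of alternants\<close>

text \<open>The variables \<open>x\<^sub>i = y\<^sub>i + N - 1 - i\<close> of the factorial Schur polynomial behind a shifted one.\<close>

definition shifted_var :: "nat \<Rightarrow> nat \<Rightarrow> real mpol" where
  "shifted_var N i = Var i + of_nat (N - 1 - i)"

text \<open>The numerator of a shifted Schur polynomial for an arbitrary \<open>\<alpha>\<close>, set to 0 if \<open>\<alpha>\<close> has a nonzero
  entry beyond the first \<open>N\<close>. With this convention the multiplication rule below is the same for
  all \<open>N\<close>, which makes a separate stability argument unnecessary.\<close>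

definition shifted_alternant :: "(nat \<Rightarrow> nat) \<Rightarrow> nat \<Rightarrow> real mpol" where
  "shifted_alternant \<alpha> N =
     (if \<forall>i\<ge>N. \<alpha> i = 0 then alternant (shifted_var N) \<alpha> N else 0)"

lemma shifted_alternant_inside:
  "(\<And>i. N \<le> i \<Longrightarrow> \<alpha> i = 0) \<Longrightarrow> shifted_alternant \<alpha> N = alternant (shifted_var N) \<alpha> N"
  by (simp add: shifted_alternant_def)

lemma shifted_alternant_outside:
  "N \<le> i \<Longrightarrow> \<alpha> i \<noteq> 0 \<Longrightarrow> shifted_alternant \<alpha> N = 0"
  by (auto simp: shifted_alternant_def)

abbreviation shifted_vandermonde :: "nat \<Rightarrow> real mpol" where
  "shifted_vandermonde N \<equiv> difference_product (shifted_var N) N"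

lemma difference_product_nonzero:
  fixes v :: "nat \<Rightarrow> real"
  assumes "\<And>i j. i < j \<Longrightarrow> j < N \<Longrightarrow> pev (\<lambda>x. x) v (x i) \<noteq> pev (\<lambda>x. x) v (x j)"
  shows "difference_product x N \<noteq> 0"
proof
  assume "difference_product x N = 0"
  then have "difference_product (\<lambda>i. pev (\<lambda>x. x) v (x i)) N = 0"
    using difference_product_hom[OF comm_ring_hom_pev[OF comm_ring_hom_id], of v x N]
    by (simp add: pev_zero[OF comm_ring_hom_id])
  then show False using assms by (auto simp: difference_product_def)
qed

lemma vandermonde_nonzero: "vandermonde N \<noteq> 0"
  unfolding vandermonde_eq
  by (rule difference_product_nonzero[where v = real]) (simp add: pev_Var[OF comm_ring_hom_id])

lemma of_nat_eq_Const: "of_nat n = (Const (of_nat n) :: 'a::comm_ring_1 mpol)"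
  by (simp add: Const.hom_of_nat)

lemma shifted_vandermonde_nonzero: "shifted_vandermonde N \<noteq> 0"
  by (rule difference_product_nonzero[where v = "\<lambda>_. 0"])
     (simp add: shifted_var_def pev_add[OF comm_ring_hom_id] pev_Var[OF comm_ring_hom_id]
       pev_Const[OF comm_ring_hom_id] of_nat_eq_Const)

lemma shifted_schur_mult_vandermonde:
  assumes "\<nu> \<in> young"
  shows "shifted_schur \<nu> N * shifted_vandermonde N = shifted_alternant (row_len \<nu>) N"
proof (cases "num_rows \<nu> \<le> N")
  case False
  then obtain i where "N \<le> i" "row_len \<nu> i \<noteq> 0" using assms by (auto simp: num_rows_le_iff)
  moreover have "shifted_schur \<nu> N = 0"
    using False by (simp add: shifted_schur_def factorial_schur_def subst.hom_zero)
  ultimately show ?thesis by (simp add: shifted_alternant_outside)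
next
  case True
  let ?A = "alternant Var (row_len \<nu>) N :: real mpol"
  have "\<exists>q. q * vandermonde N = ?A"
    using difference_product_dvd_alternant[of Var N "row_len \<nu>"]
    by (metis vandermonde_eq dvd_def mult.commute)
  moreover have "q = q'" if "q * vandermonde N = ?A" "q' * vandermonde N = ?A" for q q'
    using that vandermonde_nonzero[of N] by (metis mult_right_cancel)
  ultimately have "\<exists>!q. q * vandermonde N = ?A" by blast
  from theI'[OF this] have "factorial_schur \<nu> N * vandermonde N = ?A"
    using True by (simp add: factorial_schur_def alternant_def)
  moreover have "shifted_schur \<nu> N = subst (shifted_var N) (factorial_schur \<nu> N)"
    by (simp add: shifted_schur_def shifted_var_def[abs_def])
  ultimately have "shifted_schur \<nu> N * subst (shifted_var N) (vandermonde N) = subst (shifted_var N) ?A"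
    by (simp flip: subst.hom_mult)
  then show ?thesis
    using True assms
    by (simp add: vandermonde_eq difference_product_hom[OF comm_ring_hom_subst]
        alternant_hom[OF comm_ring_hom_subst] shifted_alternant_inside num_rows_le_iff)
qed

lemma shifted_schur_empty: "shifted_schur {} N = 1"
proof -
  have "row_len {} = (\<lambda>_. 0)" by (simp add: row_len_def fun_eq_iff)
  then have "shifted_schur {} N * shifted_vandermonde N = 1 * shifted_vandermonde N"
    by (simp add: shifted_schur_mult_vandermonde shifted_alternant_inside alternant_zero)
  then show ?thesis using shifted_vandermonde_nonzero[of N] by (metis mult_right_cancel)
qed

lemma step_coeff_Const: "step_coeff k r (Const a) = Const (step_coeff k r a)"
  by (induction k arbitrary: r)
     (simp_all add: Const.hom_add Const.hom_mult of_nat_eq_Const)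

text \<open>In the shifted variables, \<open>pstar k N\<close> is \<open>\<Sum>\<^sub>j (x\<^sub>j + 1/2 - N)^k\<close> minus a constant, and
  \<open>\<alpha>\<^sub>i + N - 1 - i + (1/2 - N) = \<alpha>\<^sub>i - i - 1/2\<close>. So neither the coefficients nor the ranges of summation
  on the right depend on \<open>N\<close>.\<close>

lemma pstar_mult_shifted_alternant:
  assumes L: "\<And>i. L \<le> i \<Longrightarrow> \<alpha> i = 0"
  shows "pstar k N * shifted_alternant \<alpha> N =
      (\<Sum>i<L + k. \<Sum>r=1..k. scale (step_coeff k r (real (\<alpha> i) - real i - 1/2))
         (shifted_alternant (\<alpha>(i := \<alpha> i + r)) N))
    + scale (\<Sum>i<L. (real (\<alpha> i) - real i - 1/2) ^ k - (- real i - 1/2) ^ k) (shifted_alternant \<alpha> N)"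
    (is "_ = (\<Sum>i<L + k. ?f i) + scale (\<Sum>i<L. ?d i) _")
proof (cases "\<forall>i\<ge>N. \<alpha> i = 0")
  case False
  then obtain j where j: "j \<ge> N" "\<alpha> j \<noteq> 0" by blast
  then have "shifted_alternant (\<alpha>(i := \<alpha> i + r)) N = 0" for i r
    by (intro shifted_alternant_outside[of N j]) auto
  then show ?thesis using shifted_alternant_outside[of N j \<alpha>] j by (simp add: scale_def)
next
  case True
  let ?x = "shifted_var N" and ?u = "Const (1/2 - real N) :: real mpol"
  have exponent: "of_nat (\<alpha> i + N - 1 - i) + ?u = Const (real (\<alpha> i) - real i - 1/2)"
    if "i < N" for i
  proof -
    have "\<alpha> i + N - 1 - i = \<alpha> i + (N - 1 - i)" using that by linarith
    then show ?thesis using that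
      by (simp add: of_nat_eq_Const of_nat_diff algebra_simps flip: Const.hom_add)
  qed
  have pstar: "pstar k N = (\<Sum>j<N. (?x j + ?u) ^ k) - (\<Sum>i<N. Const ((- real i - 1/2) ^ k))"
    unfolding pstar_def sum_subtractf
    by (intro arg_cong2[where f = "(-)"] sum.cong refl arg_cong[where f = "\<lambda>y. y ^ k"])
       (simp add: shifted_var_def of_nat_eq_Const of_nat_diff algebra_simps flip: Const.hom_add)
  have split: "{..k} = insert 0 {1..k}" by auto
  have alt: "shifted_alternant (\<alpha>(i := \<alpha> i + r)) N = alternant ?x (\<alpha>(i := \<alpha> i + r)) N"
    if "i < N" for i r
    using that True by (intro shifted_alternant_inside) auto
  have "(\<Sum>j<N. (?x j + ?u) ^ k) * shifted_alternant \<alpha> N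
      = (\<Sum>i<N. \<Sum>r\<le>k. step_coeff k r (of_nat (\<alpha> i + N - 1 - i) + ?u) * alternant ?x (\<alpha>(i := \<alpha> i + r)) N)"
    using True by (simp add: shifted_alternant_inside power_sum_mult_alternant)
  also have "\<dots> = (\<Sum>i<N. \<Sum>r\<le>k. scale (step_coeff k r (real (\<alpha> i) - real i - 1/2))
         (shifted_alternant (\<alpha>(i := \<alpha> i + r)) N))"
    by (intro sum.cong refl) (simp only: lessThan_iff exponent step_coeff_Const scale_def alt)
  also have "\<dots> = (\<Sum>i<N. ?f i + scale ((real (\<alpha> i) - real i - 1/2) ^ k) (shifted_alternant \<alpha> N))"
    unfolding split by (intro sum.cong refl) (simp add: step_coeff_0 add.commute)
  also have "\<dots> = (\<Sum>i<N. ?f i) + (\<Sum>i<N. scale ((real (\<alpha> i) - real i - 1/2) ^ k) (shifted_alternant \<alpha> N))"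
    by (rule sum.distrib)
  finally have "pstar k N * shifted_alternant \<alpha> N
      = (\<Sum>i<N. ?f i) + (\<Sum>i<N. scale (?d i) (shifted_alternant \<alpha> N))"
    by (simp add: pstar left_diff_distrib scale_def sum_distrib_right sum_subtractf Const.hom_minus)
  also have "(\<Sum>i<N. ?f i) = (\<Sum>i<L + k. ?f i)"
  proof -
    have "?f i = 0" if "\<not> i < N" for i
    proof (rule sum.neutral, intro ballI)
      fix r assume "r \<in> {1..k}"
      then have "shifted_alternant (\<alpha>(i := \<alpha> i + r)) N = 0" using that
        by (intro shifted_alternant_outside[of N i]) auto
      then show "scale (step_coeff k r (real (\<alpha> i) - real i - 1/2))
         (shifted_alternant (\<alpha>(i := \<alpha> i + r)) N) = 0"
        by (simp add: scale_def)
    qed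
    moreover have "?f i = 0" if "\<not> i < L + k" "i < N" for i
    proof (rule sum.neutral, intro ballI)
      fix r assume r: "r \<in> {1..k}"
      \<comment> \<open>Rows \<open>i - r\<close> and \<open>i\<close> both have index at least \<open>L\<close>; raising row \<open>i\<close> by \<open>r\<close> makes them equal.\<close>
      have "alternant ?x (\<alpha>(i := \<alpha> i + r)) N = 0"
        by (rule alternant_equal_exponents[of "i - r" i]) (use r that L in auto)
      then show "scale (step_coeff k r (real (\<alpha> i) - real i - 1/2))
         (shifted_alternant (\<alpha>(i := \<alpha> i + r)) N) = 0"
        using that(2) by (simp add: alt scale_def)
    qed
    ultimately show ?thesis
      by (intro sum.mono_neutral_cong) (auto simp: not_less)
  qed
  also have "(\<Sum>i<N. scale (?d i) (shifted_alternant \<alpha> N)) = scale (\<Sum>i<N. ?d i) (shifted_alternant \<alpha> N)"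
    by (simp add: scale_def Const.hom_sum sum_distrib_right)
  also have "(\<Sum>i<N. ?d i) = (\<Sum>i<L. ?d i)"
    using True L by (intro sum.mono_neutral_cong) (auto simp: not_less)
  finally show ?thesis .
qed

section \<open>Multiplication by power sums on the span of the shifted Schur functions\<close>

text \<open>Scalar multiplication on sequences \<open>(f\<^sub>N)\<close> of polynomials, the ambient vector space of \<open>Sym\<^sup>*\<close>.
  Sequences start at \<open>N = 0\<close> here; the extra term does no harm, since the multiplication rule
  holds for \<open>N = 0\<close> too.\<close>

definition seq_scale :: "real \<Rightarrow> (nat \<Rightarrow> real mpol) \<Rightarrow> nat \<Rightarrow> real mpol" where
  "seq_scale c f = (\<lambda>N. scale c (f N))"

interpretation seq: vector_space seq_scale
  by unfold_locales
     (simp_all add: seq_scale_def scale_def fun_eq_iff algebra_simps Const.hom_add Const.hom_mult)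

text \<open>The span of the \<open>S\<^sup>*\<^sub>\<nu>\<close> with \<open>|\<nu>| \<le> n\<close>.\<close>

definition schur_span :: "nat \<Rightarrow> (nat \<Rightarrow> real mpol) set" where
  "schur_span n = seq.span (shifted_schur ` {\<nu> \<in> young. card \<nu> \<le> n})"

text \<open>Straightening: a sequence that is decreasing except for one raised entry \<open>\<alpha>\<^sub>i\<close> gives, up to sign,
  the numerator of a shifted Schur polynomial, or 0. The raised entry is moved up by adjacent
  interchanges; each lets the entry passed over grow by one, which is why the third hypothesis
  allows an excess of one.\<close>

lemma shifted_alternant_straighten:
  assumes "\<And>t. L \<le> t \<Longrightarrow> \<alpha> t = 0"
    and "\<And>t. Suc t \<noteq> i \<Longrightarrow> \<alpha> (Suc t) \<le> \<alpha> t"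
    and "\<And>t. Suc t = i \<Longrightarrow> \<alpha> (Suc (Suc t)) \<le> \<alpha> t + 1"
    and "(\<Sum>t<L. \<alpha> t) \<le> n"
  shows "\<exists>g\<in>schur_span n. \<forall>N. g N * shifted_vandermonde N = shifted_alternant \<alpha> N"
  using assms
proof (induction i arbitrary: \<alpha>)
  have partition: "\<exists>g\<in>schur_span n. \<forall>N. g N * shifted_vandermonde N = shifted_alternant \<alpha> N"
    if "\<And>t. \<alpha> (Suc t) \<le> \<alpha> t" "\<And>t. L \<le> t \<Longrightarrow> \<alpha> t = 0" "(\<Sum>t<L. \<alpha> t) \<le> n" for \<alpha>
  proof
    let ?\<nu> = "{(i, j). j < \<alpha> i}"
    note \<nu> = diagram_of_rows[of \<alpha> L, OF that(1,2)]
    show "shifted_schur ?\<nu> \<in> schur_span n"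
      unfolding schur_span_def by (intro seq.span_base imageI) (use \<nu> that(3) in simp)
    show "\<forall>N. shifted_schur ?\<nu> N * shifted_vandermonde N = shifted_alternant \<alpha> N"
      using shifted_schur_mult_vandermonde[OF \<nu>(1)] \<nu>(2) by simp
  qed
  {
    case 0
    then show ?case by (intro partition) auto
  next
    case (Suc i)
    consider "\<alpha> (Suc i) \<le> \<alpha> i" | "\<alpha> (Suc i) = \<alpha> i + 1" | "\<alpha> (Suc i) > \<alpha> i + 1" by linarith
    then show ?case
    proof cases
      case 1
      have "\<alpha> (Suc t) \<le> \<alpha> t" for t
        using 1 Suc.prems(2)[of t] by (cases "t = i") auto
      then show ?thesis using Suc.prems(1,4) by (intro partition) auto
    next
      case 2
      have "shifted_alternant \<alpha> N = 0" for N
      proof (cases "N \<le> Suc i")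
        case True
        then show ?thesis using 2 by (intro shifted_alternant_outside) auto
      next
        case False
        then have "alternant (shifted_var N) \<alpha> N = 0"
          using 2 by (intro alternant_equal_exponents[of i "Suc i"]) auto
        then show ?thesis by (simp add: shifted_alternant_def)
      qed
      then show ?thesis
        by (intro bexI[of _ 0]) (auto simp: schur_span_def seq.span_zero)
    next
      case 3
      let ?\<beta> = "\<alpha>(i := \<alpha> (Suc i) - 1, Suc i := \<alpha> i + 1)"
      have iL: "Suc i < L" using 3 Suc.prems(1)[of "Suc i"] by (cases "Suc i < L") auto
      have "\<exists>g\<in>schur_span n. \<forall>N. g N * shifted_vandermonde N = shifted_alternant ?\<beta> N"
      proof (rule Suc.IH)
        show "?\<beta> t = 0" if "L \<le> t" for t using that iL Suc.prems(1) by auto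
        show "?\<beta> (Suc t) \<le> ?\<beta> t" if "Suc t \<noteq> i" for t
          using that 3 Suc.prems(2)[of t] Suc.prems(3)[of i] by auto
        show "?\<beta> (Suc (Suc t)) \<le> ?\<beta> t + 1" if "Suc t = i" for t
          using that Suc.prems(2)[of t] by auto
        have "(\<Sum>t<L. ?\<beta> t) = (\<Sum>t<L. \<alpha> t)"
          using iL 3 by (simp add: sum.remove[of "{..<L}" i] sum.remove[of "{..<L} - {i}" "Suc i"])
        then show "(\<Sum>t<L. ?\<beta> t) \<le> n" using Suc.prems(4) by simp
      qed
      then obtain g where g: "g \<in> schur_span n"
        "\<And>N. g N * shifted_vandermonde N = shifted_alternant ?\<beta> N" by blast
      have "shifted_alternant ?\<beta> N = - shifted_alternant \<alpha> N" for N
      proof (cases "\<forall>t\<ge>N. \<alpha> t = 0")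
        case True
        then have N: "\<not> N \<le> Suc i" using 3 by auto
        then have "alternant (shifted_var N) ?\<beta> N = - alternant (shifted_var N) \<alpha> N"
          using 3 by (intro alternant_swap) auto
        moreover have "shifted_alternant ?\<beta> N = alternant (shifted_var N) ?\<beta> N"
          using True N by (intro shifted_alternant_inside) auto
        moreover have "shifted_alternant \<alpha> N = alternant (shifted_var N) \<alpha> N"
          using True by (intro shifted_alternant_inside) auto
        ultimately show ?thesis by metis
      next
        case False
        then obtain t where t: "N \<le> t" "\<alpha> t \<noteq> 0" by blast
        have "shifted_alternant ?\<beta> N = 0"
        proof (cases "N \<le> Suc i")
          case True
          then show ?thesis by (intro shifted_alternant_outside[of N "Suc i"]) auto
        next
          case False
          then show ?thesis using t by (intro shifted_alternant_outside[of N t]) auto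
        qed
        then show ?thesis using shifted_alternant_outside[of N t \<alpha>] t by simp
      qed
      then show ?thesis
        using g by (intro bexI[of _ "- g"]) (auto simp: schur_span_def seq.span_neg)
    qed
  }
qed

lemma pstar_mult_shifted_schur:
  assumes "\<nu> \<in> young" "card \<nu> \<le> n"
  shows "(\<lambda>N. pstar k N * shifted_schur \<nu> N) \<in> schur_span (n + k)"
proof -
  let ?L = "card \<nu>" and ?\<alpha> = "row_len \<nu>"
  let ?c = "\<lambda>i r. step_coeff k r (real (?\<alpha> i) - real i - 1/2)"
  let ?d = "\<Sum>i<?L. (real (?\<alpha> i) - real i - 1/2) ^ k - (- real i - 1/2) ^ k"
  have L: "?\<alpha> i = 0" if "?L \<le> i" for i using that assms by (simp add: row_len_eq_0)
  have anti: "?\<alpha> i' \<le> ?\<alpha> i" if "i \<le> i'" for i i' using row_len_antimono[OF assms(1) that] .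
  have "\<exists>g\<in>schur_span (n + k). \<forall>N. g N * shifted_vandermonde N = shifted_alternant (?\<alpha>(i := ?\<alpha> i + r)) N"
    if "i < ?L + k" "r \<in> {1..k}" for i r
  proof (rule shifted_alternant_straighten[where L = "?L + k" and i = i])
    show "(?\<alpha>(i := ?\<alpha> i + r)) t = 0" if "?L + k \<le> t" for t
      using that \<open>i < ?L + k\<close> L by auto
    show "(?\<alpha>(i := ?\<alpha> i + r)) (Suc t) \<le> (?\<alpha>(i := ?\<alpha> i + r)) t" if "Suc t \<noteq> i" for t
      using that anti[of t "Suc t"] by auto
    show "(?\<alpha>(i := ?\<alpha> i + r)) (Suc (Suc t)) \<le> (?\<alpha>(i := ?\<alpha> i + r)) t + 1" if "Suc t = i" for t
      using that anti[of t "Suc (Suc t)"] by auto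
    have "card \<nu> = (\<Sum>t<?L + k. ?\<alpha> t)" using L by (intro card_young assms) auto
    then show "(\<Sum>t<?L + k. (?\<alpha>(i := ?\<alpha> i + r)) t) \<le> n + k"
      using that assms(2) by (simp add: sum.remove[of "{..<?L + k}" i])
  qed
  then obtain g where g: "\<And>i r. i < ?L + k \<Longrightarrow> r \<in> {1..k} \<Longrightarrow> g i r \<in> schur_span (n + k)"
    "\<And>i r N. i < ?L + k \<Longrightarrow> r \<in> {1..k} \<Longrightarrow>
       g i r N * shifted_vandermonde N = shifted_alternant (?\<alpha>(i := ?\<alpha> i + r)) N"
    by metis
  let ?G = "(\<Sum>i<?L + k. \<Sum>r=1..k. seq_scale (?c i r) (g i r)) + seq_scale ?d (shifted_schur \<nu>)"
  have sum_apply: "(\<Sum>i\<in>I. f i) N = (\<Sum>i\<in>I. f i N)"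
    for I :: "nat set" and f :: "nat \<Rightarrow> nat \<Rightarrow> real mpol" and N
    by (induction I rule: infinite_finite_induct) auto
  have "(\<lambda>N. pstar k N * shifted_schur \<nu> N) = ?G"
  proof
    fix N
    have "pstar k N * shifted_schur \<nu> N * shifted_vandermonde N = pstar k N * shifted_alternant ?\<alpha> N"
      by (simp add: mult.assoc shifted_schur_mult_vandermonde assms)
    also have "\<dots> = (\<Sum>i<?L + k. \<Sum>r=1..k. scale (?c i r) (shifted_alternant (?\<alpha>(i := ?\<alpha> i + r)) N))
        + scale ?d (shifted_alternant ?\<alpha> N)"
      by (rule pstar_mult_shifted_alternant) (rule L)
    also have "(\<Sum>i<?L + k. \<Sum>r=1..k. scale (?c i r) (shifted_alternant (?\<alpha>(i := ?\<alpha> i + r)) N))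
        = (\<Sum>i<?L + k. \<Sum>r=1..k. scale (?c i r) (g i r N)) * shifted_vandermonde N"
      unfolding sum_distrib_right
      by (intro sum.cong refl) (simp only: scale_def mult.assoc g(2) lessThan_iff)
    also have "scale ?d (shifted_alternant ?\<alpha> N) = scale ?d (shifted_schur \<nu> N) * shifted_vandermonde N"
      unfolding scale_def mult.assoc shifted_schur_mult_vandermonde[OF assms(1)] ..
    also have "(\<Sum>i<?L + k. \<Sum>r=1..k. scale (?c i r) (g i r N)) * shifted_vandermonde N
        + scale ?d (shifted_schur \<nu> N) * shifted_vandermonde N
        = ((\<Sum>i<?L + k. \<Sum>r=1..k. scale (?c i r) (g i r N)) + scale ?d (shifted_schur \<nu> N))
          * shifted_vandermonde N"
      by (rule distrib_right[symmetric])
    also have "(\<Sum>i<?L + k. \<Sum>r=1..k. scale (?c i r) (g i r N)) + scale ?d (shifted_schur \<nu> N) = ?G N"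
      by (simp only: plus_fun_apply sum_apply seq_scale_def)
    finally show "pstar k N * shifted_schur \<nu> N = ?G N"
      by (simp only: mult_right_cancel[OF shifted_vandermonde_nonzero])
  qed
  also have "?G \<in> schur_span (n + k)"
    using g(1) assms unfolding schur_span_def
    by (intro seq.span_add seq.span_sum seq.span_scale)
       (auto intro: seq.span_base)
  finally show ?thesis .
qed

lemma pstar_mult_schur_span:
  assumes "f \<in> schur_span n"
  shows "(\<lambda>N. pstar k N * f N) \<in> schur_span (n + k)"
  using assms unfolding schur_span_def[of n]
proof (induction rule: seq.span_induct_alt)
  case base
  have "(\<lambda>N. pstar k N * (0 :: nat \<Rightarrow> real mpol) N) = 0" by auto
  then show ?case by (simp only: schur_span_def seq.span_zero)
next
  case (step c x y)
  then obtain \<nu> where \<nu>: "\<nu> \<in> young" "card \<nu> \<le> n" "x = shifted_schur \<nu>" by auto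
  have "(\<lambda>N. pstar k N * (seq_scale c x + y) N)
      = seq_scale c (\<lambda>N. pstar k N * x N) + (\<lambda>N. pstar k N * y N)"
    by (auto simp: seq_scale_def scale_def algebra_simps)
  then show ?case
    using step pstar_mult_shifted_schur[OF \<nu>(1,2), of k] \<nu>(3)
    unfolding schur_span_def by (simp add: seq.span_add seq.span_scale)
qed

section \<open>Algebraic independence of the power sums\<close>

text \<open>The formal partial derivative with respect to \<open>Var k\<close>. Where the subtraction of
  exponents is truncated, the coefficient is 0.\<close>

definition mpderiv :: "nat \<Rightarrow> real mpol \<Rightarrow> real mpol" where
  "mpderiv k F = (\<Sum>m\<in>Poly_Mapping.keys F.
     Poly_Mapping.single (m - Poly_Mapping.single k 1)
       (real (Poly_Mapping.lookup m k) * Poly_Mapping.lookup F m))"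

lemma lookup_mpderiv:
  "Poly_Mapping.lookup (mpderiv k F) m =
     real (Poly_Mapping.lookup m k + 1) * Poly_Mapping.lookup F (m + Poly_Mapping.single k 1)"
proof -
  let ?m = "m + Poly_Mapping.single k 1"
  have "Poly_Mapping.lookup (mpderiv k F) m = (\<Sum>m'\<in>Poly_Mapping.keys F.
      if m' = ?m then real (Poly_Mapping.lookup ?m k) * Poly_Mapping.lookup F ?m else 0)"
    unfolding mpderiv_def lookup_sum
  proof (intro sum.cong refl)
    fix m'
    show "Poly_Mapping.lookup (Poly_Mapping.single (m' - Poly_Mapping.single k 1)
         (real (Poly_Mapping.lookup m' k) * Poly_Mapping.lookup F m')) m
       = (if m' = ?m then real (Poly_Mapping.lookup ?m k) * Poly_Mapping.lookup F ?m else 0)"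
    proof (cases "Poly_Mapping.lookup m' k = 0")
      case True
      then have "m' \<noteq> ?m" by (auto simp: lookup_add)
      then show ?thesis using True by simp
    next
      case False
      have "m' - Poly_Mapping.single k 1 = m \<longleftrightarrow> m' = ?m"
      proof
        assume *: "m' - Poly_Mapping.single k 1 = m"
        show "m' = ?m"
          using False by (intro poly_mapping_eqI)
            (auto simp: lookup_add lookup_minus lookup_single when_def simp flip: *)
      qed simp
      then show ?thesis by (auto simp: lookup_single when_def)
    qed
  qed
  also have "\<dots> = real (Poly_Mapping.lookup m k + 1) * Poly_Mapping.lookup F ?m"
    by (auto simp: in_keys_iff lookup_add)
  finally show ?thesis .
qed

lemma keys_mpderiv:
  assumes "m \<in> Poly_Mapping.keys (mpderiv k F)"
  shows "m + Poly_Mapping.single k 1 \<in> Poly_Mapping.keys F"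
  using assms by (auto simp: in_keys_iff lookup_mpderiv)

abbreviation peval :: "(nat \<Rightarrow> real) \<Rightarrow> real mpol \<Rightarrow> real" where
  "peval \<equiv> pev (\<lambda>x. x)"

lemma peval_mpderiv:
  assumes K: "finite K" "\<And>m. m \<in> Poly_Mapping.keys F \<Longrightarrow> Poly_Mapping.keys m \<subseteq> K" and k: "k \<in> K"
  shows "peval p (mpderiv k F) = (\<Sum>m\<in>Poly_Mapping.keys F. Poly_Mapping.lookup F m *
     (real (Poly_Mapping.lookup m k) * p k ^ (Poly_Mapping.lookup m k - 1) *
       (\<Prod>i\<in>K - {k}. p i ^ Poly_Mapping.lookup m i)))"
  unfolding mpderiv_def pev_sum[OF comm_ring_hom_id] pev_single[OF comm_ring_hom_id]
proof (intro sum.cong refl)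
  fix m assume m: "m \<in> Poly_Mapping.keys F"
  let ?m = "m - Poly_Mapping.single k 1"
  have "Poly_Mapping.keys ?m \<subseteq> K"
    using K(2)[OF m] by (auto simp: in_keys_iff lookup_minus)
  then have "(\<Prod>i\<in>Poly_Mapping.keys ?m. p i ^ Poly_Mapping.lookup ?m i)
      = (\<Prod>i\<in>K. p i ^ Poly_Mapping.lookup ?m i)"
    using K(1) by (rule monomial_value_superset[rotated])
  also have "\<dots> = p k ^ (Poly_Mapping.lookup m k - 1) * (\<Prod>i\<in>K - {k}. p i ^ Poly_Mapping.lookup m i)"
    using K(1) k by (subst prod.remove[of _ k]) (auto simp: lookup_minus lookup_single when_def intro!: prod.cong)
  finally show "real (Poly_Mapping.lookup m k) * Poly_Mapping.lookup F m *
      (\<Prod>i\<in>Poly_Mapping.keys ?m. p i ^ Poly_Mapping.lookup ?m i)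
    = Poly_Mapping.lookup F m * (real (Poly_Mapping.lookup m k) * p k ^ (Poly_Mapping.lookup m k - 1) *
       (\<Prod>i\<in>K - {k}. p i ^ Poly_Mapping.lookup m i))"
    by (simp add: mult_ac)
qed

lemma DERIV_peval:
  fixes p :: "real \<Rightarrow> nat \<Rightarrow> real"
  assumes K: "finite K" "\<And>m. m \<in> Poly_Mapping.keys F \<Longrightarrow> Poly_Mapping.keys m \<subseteq> K"
    and p: "\<And>k. k \<in> K \<Longrightarrow> ((\<lambda>t. p t k) has_field_derivative q k) (at t)"
  shows "((\<lambda>t. peval (p t) F) has_field_derivative (\<Sum>k\<in>K. peval (p t) (mpderiv k F) * q k)) (at t)"
proof -
  have "peval (p t) F = (\<Sum>m\<in>Poly_Mapping.keys F. Poly_Mapping.lookup F m *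
      (\<Prod>i\<in>K. p t i ^ Poly_Mapping.lookup m i))" for t
    unfolding pev_def using K
    by (intro sum.cong refl arg_cong2[where f = "(*)"] monomial_value_superset) auto
  moreover have "((\<lambda>t. \<Sum>m\<in>Poly_Mapping.keys F. Poly_Mapping.lookup F m *
      (\<Prod>i\<in>K. p t i ^ Poly_Mapping.lookup m i)) has_field_derivative
      (\<Sum>m\<in>Poly_Mapping.keys F. Poly_Mapping.lookup F m *
        (\<Sum>k\<in>K. (real (Poly_Mapping.lookup m k) * p t k ^ (Poly_Mapping.lookup m k - 1) * q k) *
          (\<Prod>i\<in>K - {k}. p t i ^ Poly_Mapping.lookup m i)))) (at t)"
    by (intro DERIV_sum DERIV_cmult has_field_derivative_prod)
       (auto intro!: derivative_eq_intros p)
  moreover have "(\<Sum>m\<in>Poly_Mapping.keys F. Poly_Mapping.lookup F m *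
        (\<Sum>k\<in>K. (real (Poly_Mapping.lookup m k) * p t k ^ (Poly_Mapping.lookup m k - 1) * q k) *
          (\<Prod>i\<in>K - {k}. p t i ^ Poly_Mapping.lookup m i)))
      = (\<Sum>k\<in>K. peval (p t) (mpderiv k F) * q k)"
  proof -
    have "(\<Sum>k\<in>K. peval (p t) (mpderiv k F) * q k)
       = (\<Sum>k\<in>K. \<Sum>m\<in>Poly_Mapping.keys F. Poly_Mapping.lookup F m *
         ((real (Poly_Mapping.lookup m k) * p t k ^ (Poly_Mapping.lookup m k - 1) * q k) *
          (\<Prod>i\<in>K - {k}. p t i ^ Poly_Mapping.lookup m i)))"
      by (intro sum.cong refl, subst peval_mpderiv[OF K]) (simp_all add: sum_distrib_left sum_distrib_right mult_ac)
    then show ?thesis by (subst (asm) sum.swap) (simp add: sum_distrib_left)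
  qed
  ultimately show ?thesis by simp
qed

lemma eq_Const_if_mpderiv_eq_0:
  assumes "\<And>m. m \<in> Poly_Mapping.keys F \<Longrightarrow> Poly_Mapping.keys m \<subseteq> K"
    and "\<And>k. k \<in> K \<Longrightarrow> mpderiv k F = 0"
  shows "F = Const (Poly_Mapping.lookup F 0)"
proof (rule poly_mapping_eqI)
  fix m
  show "Poly_Mapping.lookup F m = Poly_Mapping.lookup (Const (Poly_Mapping.lookup F 0)) m"
  proof (cases "m = 0")
    case False
    then obtain k where k: "Poly_Mapping.lookup m k \<noteq> 0"
      by (metis poly_mapping_eqI lookup_zero)
    have "Poly_Mapping.lookup F m = 0"
    proof (rule ccontr)
      assume *: "Poly_Mapping.lookup F m \<noteq> 0"
      then have "k \<in> K" using assms(1)[of m] k by (auto simp: in_keys_iff)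
      let ?m = "m - Poly_Mapping.single k 1"
      have "?m + Poly_Mapping.single k 1 = m"
        using k by (intro poly_mapping_eqI) (auto simp: lookup_add lookup_minus lookup_single when_def)
      then have "Poly_Mapping.lookup (mpderiv k F) ?m \<noteq> 0"
        using * k by (simp add: lookup_mpderiv)
      then show False using assms(2)[OF \<open>k \<in> K\<close>] by simp
    qed
    then show ?thesis using False by (simp add: Const_def lookup_single when_def)
  qed (simp add: Const_def)
qed

text \<open>The Jacobian criterion. If \<open>F\<close> vanishes at all power sums of distinct \<open>u\<^sub>0, \<dots>, u\<^sub>K\<^sub>-\<^sub>1\<close>, shifted by
  constants \<open>c\<^sub>k\<close>, then differentiating in \<open>u\<^sub>j\<close> shows that a polynomial of degree below \<open>K\<close> with
  coefficients \<open>(k + 1) (\<partial>\<^sub>k F)\<close> has the \<open>K\<close> roots \<open>u\<^sub>j\<close>. So all \<open>\<partial>\<^sub>k F\<close> vanish at the same points, and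
  induction on the degree bound \<open>d\<close> applies.\<close>

lemma shifted_power_sums_independent:
  fixes F :: "real mpol" and c :: "nat \<Rightarrow> real"
  assumes "\<And>m. m \<in> Poly_Mapping.keys F \<Longrightarrow> Poly_Mapping.keys m \<subseteq> {..<K}"
    and "\<And>m. m \<in> Poly_Mapping.keys F \<Longrightarrow> (\<Sum>k<K. Poly_Mapping.lookup m k) \<le> d"
    and "\<And>u. inj_on u {..<K} \<Longrightarrow> peval (\<lambda>k. c k + (\<Sum>i<K. u i ^ Suc k)) F = 0"
  shows "F = 0"
  using assms
proof (induction d arbitrary: F)
  have const: "F = 0"
    if "\<And>m. m \<in> Poly_Mapping.keys F \<Longrightarrow> Poly_Mapping.keys m \<subseteq> {..<K}"
      "\<And>k. k < K \<Longrightarrow> mpderiv k F = 0"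
      "\<And>u. inj_on u {..<K} \<Longrightarrow> peval (\<lambda>k. c k + (\<Sum>i<K. u i ^ Suc k)) F = 0" for F
  proof -
    have F: "F = Const (Poly_Mapping.lookup F 0)"
      using that(1,2) by (intro eq_Const_if_mpderiv_eq_0[of F "{..<K}"]) auto
    have "peval (\<lambda>k. c k + (\<Sum>i<K. real i ^ Suc k)) F = 0"
      by (rule that(3)) simp
    then have "Poly_Mapping.lookup F 0 = 0"
      by (subst (asm) F) (simp only: pev_Const[OF comm_ring_hom_id])
    then show ?thesis by (subst F) (simp add: Const.hom_zero)
  qed
  {
    case 0
    have deriv: "mpderiv k F = 0" if "k < K" for k
    proof (rule poly_mapping_eqI)
      fix m
      have "m + Poly_Mapping.single k 1 \<notin> Poly_Mapping.keys F"
      proof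
        assume "m + Poly_Mapping.single k 1 \<in> Poly_Mapping.keys F"
        from 0(2)[OF this] have "Poly_Mapping.lookup (m + Poly_Mapping.single k 1) k = 0"
          using that by auto
        then show False by (simp add: lookup_add)
      qed
      then show "Poly_Mapping.lookup (mpderiv k F) m = Poly_Mapping.lookup 0 m"
        by (simp add: lookup_mpderiv in_keys_iff)
    qed
    show ?case by (rule const) (fact 0(1), fact deriv, fact 0(3))
  next
    case (Suc d)
    let ?p = "\<lambda>u k. c k + (\<Sum>i<K. u i ^ Suc k)"
    have vanish: "peval (?p u) (mpderiv k F) = 0" if u: "inj_on u {..<K}" and k: "k < K"
      for u :: "nat \<Rightarrow> real" and k
    proof -
      let ?a = "\<lambda>k. peval (?p u) (mpderiv k F) * real (Suc k)"
      let ?Q = "\<Sum>k<K. monom (?a k) k"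
      have root: "poly ?Q (u j) = 0" if j: "j < K" for j
      proof -
        let ?S = "- (u ` ({..<K} - {j}))"
        have uj: "u(j := u j) = u" by simp
        \<comment> \<open>The derivative of \<open>F\<close> along \<open>u\<^sub>j\<close>, computed by the chain rule and from vanishing near \<open>u\<^sub>j\<close>.\<close>
        have "((\<lambda>t. peval (?p (u(j := t))) F) has_field_derivative
            (\<Sum>k\<in>{..<K}. peval (?p (u(j := u j))) (mpderiv k F) * (real (Suc k) * u j ^ k))) (at (u j))"
        proof (rule DERIV_peval)
          fix k
          have "((\<lambda>t. t ^ Suc k) has_field_derivative real (Suc k) * u j ^ k) (at (u j))"
            using DERIV_pow[of "Suc k" "u j"] by simp
          then have "((\<lambda>t. c k + (t ^ Suc k + (\<Sum>i\<in>{..<K} - {j}. u i ^ Suc k))) has_field_derivative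
              real (Suc k) * u j ^ k) (at (u j))"
            using DERIV_add[OF DERIV_const DERIV_add[OF _ DERIV_const]] by fastforce
          moreover have "(\<Sum>i<K. (u(j := t)) i ^ Suc k) = t ^ Suc k + (\<Sum>i\<in>{..<K} - {j}. u i ^ Suc k)" for t
            using j by (subst sum.remove[of _ j]) auto
          ultimately show "((\<lambda>t. ?p (u(j := t)) k) has_field_derivative real (Suc k) * u j ^ k) (at (u j))"
            by simp
        qed (use Suc.prems(1) in auto)
        moreover have "((\<lambda>t. peval (?p (u(j := t))) F) has_field_derivative 0) (at (u j))"
        proof (rule has_field_derivative_transform_within_open[of "\<lambda>_. 0" 0 "u j" ?S])
          show "open ?S" by (intro open_Compl finite_imp_closed) auto
          show "u j \<in> ?S" using u j by (auto simp: inj_on_def)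
          fix t assume "t \<in> ?S"
          then have "inj_on (u(j := t)) {..<K}" using u by (auto simp: inj_on_def)
          then show "0 = peval (?p (u(j := t))) F" by (rule Suc.prems(3)[symmetric])
        qed simp
        ultimately have "(\<Sum>k\<in>{..<K}. peval (?p (u(j := u j))) (mpderiv k F) * (real (Suc k) * u j ^ k)) = 0"
          by (rule DERIV_unique)
        then show ?thesis unfolding uj by (simp add: poly_sum poly_monom mult_ac)
      qed
      have "?Q = 0"
      proof (rule ccontr)
        assume Q: "?Q \<noteq> 0"
        have "K = card (u ` {..<K})" using u by (simp add: card_image)
        also have "\<dots> \<le> card {x. poly ?Q x = 0}"
          using root Q by (intro card_mono poly_roots_finite) auto
        also have "\<dots> \<le> degree ?Q" using Q by (rule card_poly_roots_bound)
        also have "\<dots> \<le> K - 1"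
          by (intro degree_sum_le) (auto intro!: degree_monom_le[THEN order_trans])
        finally show False using k by linarith
      qed
      then have "coeff ?Q k = 0" by simp
      then show ?thesis using k by (simp add: coeff_sum if_distrib sum.delta cong: if_cong)
    qed
    have deriv: "mpderiv k F = 0" if k: "k < K" for k
    proof (rule Suc.IH)
      fix m assume "m \<in> Poly_Mapping.keys (mpderiv k F)"
      note m = keys_mpderiv[OF this]
      have "Poly_Mapping.keys m \<subseteq> Poly_Mapping.keys (m + Poly_Mapping.single k 1)"
        by (auto simp: in_keys_iff lookup_add)
      then show "Poly_Mapping.keys m \<subseteq> {..<K}" using Suc.prems(1)[OF m] by simp
      have "(\<Sum>i<K. Poly_Mapping.lookup (m + Poly_Mapping.single k 1) i) = (\<Sum>i<K. Poly_Mapping.lookup m i) + 1"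
        using k by (simp add: lookup_add sum.distrib lookup_single when_def)
      then show "(\<Sum>i<K. Poly_Mapping.lookup m i) \<le> d" using Suc.prems(2)[OF m] by simp
    qed (use vanish k in auto)
    show ?case by (rule const) (fact Suc.prems(1), fact deriv, fact Suc.prems(3))
  }
qed

lemma pstar_independent:
  assumes "\<And>N. 1 \<le> N \<Longrightarrow> subst (\<lambda>k. pstar (Suc k) N) F = 0"
  shows "F = 0"
proof -
  let ?X = "\<Union>m\<in>Poly_Mapping.keys F. Poly_Mapping.keys m"
  obtain K0 where K0: "\<And>k. k \<in> ?X \<Longrightarrow> k < K0"
    using finite_nat_set_iff_bounded[of ?X] by auto
  define K where "K = Suc K0"
  define d where "d = (\<Sum>m\<in>Poly_Mapping.keys F. \<Sum>k<K. Poly_Mapping.lookup m k)"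
  let ?c = "\<lambda>k. - (\<Sum>i<K. (- real i - 1/2) ^ Suc k)"
  show ?thesis
  proof (rule shifted_power_sums_independent[of F K d ?c])
    show "Poly_Mapping.keys m \<subseteq> {..<K}" if "m \<in> Poly_Mapping.keys F" for m
      using K0 that by (force simp: K_def)
    show "(\<Sum>k<K. Poly_Mapping.lookup m k) \<le> d" if "m \<in> Poly_Mapping.keys F" for m
      unfolding d_def using that by (intro member_le_sum) auto
    fix u :: "nat \<Rightarrow> real"
    let ?v = "\<lambda>i. u i + real i + 1/2"
    interpret e: comm_ring_hom "peval ?v" by (rule comm_ring_hom_pev[OF comm_ring_hom_id])
    have "peval ?v (pstar (Suc k) K) = ?c k + (\<Sum>i<K. u i ^ Suc k)" for k
      unfolding pstar_def e.hom_sum e.hom_minus e.hom_power e.hom_add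
        pev_Var[OF comm_ring_hom_id] pev_Const[OF comm_ring_hom_id]
      by (simp add: sum_subtractf)
    then have "peval ?v (subst (\<lambda>k. pstar (Suc k) K) F) = peval (\<lambda>k. ?c k + (\<Sum>i<K. u i ^ Suc k)) F"
      by (simp add: pev_subst)
    then show "peval (\<lambda>k. ?c k + (\<Sum>i<K. u i ^ Suc k)) F = 0"
      using assms[of K] by (simp add: K_def)
  qed
qed

section \<open>Frobenius--Schur functions form a basis\<close>

text \<open>The degree of a monomial in the generators of \<open>Sym\<close>, where \<open>Var k\<close>, which represents \<open>p\<^sub>k\<^sub>+\<^sub>1\<close>, has
  degree \<open>k + 1\<close>.\<close>

definition weight :: "(nat \<Rightarrow>\<^sub>0 nat) \<Rightarrow> nat" where
  "weight m = (\<Sum>k\<in>Poly_Mapping.keys m. Suc k * Poly_Mapping.lookup m k)"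

lemma weight_superset:
  "finite I \<Longrightarrow> Poly_Mapping.keys m \<subseteq> I \<Longrightarrow> weight m = (\<Sum>k\<in>I. Suc k * Poly_Mapping.lookup m k)"
  unfolding weight_def by (intro sum.mono_neutral_left) (auto simp: in_keys_iff)

lemma weight_add_single: "weight (m + Poly_Mapping.single k 1) = weight m + Suc k"
proof -
  let ?I = "insert k (Poly_Mapping.keys m)"
  have "weight (m + Poly_Mapping.single k 1) = (\<Sum>i\<in>?I. Suc i * Poly_Mapping.lookup (m + Poly_Mapping.single k 1) i)"
    by (rule weight_superset) (auto simp: in_keys_iff lookup_add lookup_single when_def split: if_splits)
  also have "\<dots> = (\<Sum>i\<in>?I. Suc i * Poly_Mapping.lookup m i + (if i = k then Suc k else 0))"
    by (intro sum.cong refl) (auto simp: lookup_add lookup_single when_def)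
  also have "\<dots> = weight m + Suc k"
    unfolding sum.distrib by (subst weight_superset[of ?I m]) (auto simp: sum.delta)
  finally show ?thesis .
qed

text \<open>The homomorphism \<open>Sym \<rightarrow> Sym\<^sup>*\<close>, \<open>p\<^sub>k \<mapsto> p\<^sup>*\<^sub>k\<close>.\<close>

definition symstar_of :: "real sym \<Rightarrow> nat \<Rightarrow> real mpol" where
  "symstar_of F = (\<lambda>N. subst (\<lambda>k. pstar (Suc k) N) F)"

lemma symstar_of_inject: "symstar_of F = symstar_of G \<Longrightarrow> F = G"
  using pstar_independent[of "F - G"]
  by (auto simp: symstar_of_def fun_eq_iff subst.hom_minus)

abbreviation monomial :: "(nat \<Rightarrow>\<^sub>0 nat) \<Rightarrow> 'a::comm_ring_1 mpol" where
  "monomial m \<equiv> Poly_Mapping.single m 1"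

lemma symstar_of_monomial: "symstar_of (monomial m) \<in> schur_span (weight m)"
proof (induction "weight m" arbitrary: m rule: less_induct)
  case less
  show ?case
  proof (cases "m = 0")
    case True
    have "symstar_of (monomial m) = shifted_schur {}"
      by (simp add: True symstar_of_def fun_eq_iff subst.hom_one shifted_schur_empty)
    then show ?thesis by (auto simp: schur_span_def intro!: seq.span_base)
  next
    case False
    then obtain k where k: "Poly_Mapping.lookup m k \<noteq> 0"
      by (metis poly_mapping_eqI lookup_zero)
    \<comment> \<open>Splitting off one factor \<open>Var k\<close> from the monomial.\<close>
    define m' where "m' = m - Poly_Mapping.single k 1"
    have m: "m = m' + Poly_Mapping.single k 1"
      using k by (intro poly_mapping_eqI) (auto simp: m'_def lookup_add lookup_minus lookup_single when_def)
    have "monomial m = Var k * (monomial m' :: real sym)"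
      by (simp add: m Var_def mult_single add.commute)
    then have "symstar_of (monomial m) = (\<lambda>N. pstar (Suc k) N * symstar_of (monomial m') N)"
      by (simp add: symstar_of_def subst.hom_mult)
    moreover have "symstar_of (monomial m') \<in> schur_span (weight m')"
      by (rule less) (simp add: m weight_add_single del: One_nat_def)
    ultimately show ?thesis
      using pstar_mult_schur_span[of _ "weight m'" "Suc k"]
      by (simp add: m weight_add_single del: One_nat_def)
  qed
qed

text \<open>The monomial with exponents \<open>\<nu>\<^sub>k - \<nu>\<^sub>k\<^sub>+\<^sub>1\<close>, i.e. the product of the \<open>p\<^sub>c\<close> over all column lengths
  \<open>c\<close> of \<open>\<nu>\<close>. This injection shows that there are at least as many monomials as diagrams of
  size at most \<open>n\<close>.\<close>

definition row_differences :: "diagram \<Rightarrow> (nat \<Rightarrow>\<^sub>0 nat)" where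
  "row_differences \<nu> = Abs_poly_mapping (\<lambda>k. row_len \<nu> k - row_len \<nu> (Suc k))"

lemma lookup_row_differences:
  assumes "\<nu> \<in> young"
  shows "Poly_Mapping.lookup (row_differences \<nu>) k = row_len \<nu> k - row_len \<nu> (Suc k)"
proof -
  have "{k. row_len \<nu> k - row_len \<nu> (Suc k) \<noteq> 0} \<subseteq> {..<card \<nu>}"
    using row_len_eq_0[OF assms] by (auto intro: ccontr)
  then have "finite {k. row_len \<nu> k - row_len \<nu> (Suc k) \<noteq> 0}" by (rule finite_subset) simp
  then show ?thesis by (simp add: row_differences_def)
qed

lemma weight_row_differences:
  assumes "\<nu> \<in> young"
  shows "weight (row_differences \<nu>) = card \<nu>"
proof -
  let ?r = "row_len \<nu>"
  have anti: "?r (Suc k) \<le> ?r k" for k by (rule row_len_antimono[OF assms]) simp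
  \<comment> \<open>Summation by parts.\<close>
  have abel: "(\<Sum>k<L. Suc k * (?r k - ?r (Suc k))) + L * ?r L = (\<Sum>k<L. ?r k)" for L
  proof (induction L)
    case (Suc L)
    have "Suc L * (?r L - ?r (Suc L)) + Suc L * ?r (Suc L) = Suc L * ?r L"
      using anti[of L] by (simp only: add_mult_distrib2[symmetric] le_add_diff_inverse2)
    then show ?case using Suc by simp
  qed simp
  have "weight (row_differences \<nu>) = (\<Sum>k<card \<nu>. Suc k * Poly_Mapping.lookup (row_differences \<nu>) k)"
    using row_len_eq_0[OF assms]
    by (intro weight_superset) (auto simp: in_keys_iff lookup_row_differences[OF assms] intro: ccontr)
  also have "\<dots> = (\<Sum>k<card \<nu>. ?r k)"
    using abel[of "card \<nu>"] row_len_eq_0[OF assms, of "card \<nu>"] by (simp add: lookup_row_differences[OF assms])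
  also have "\<dots> = card \<nu>"
    by (rule card_young[OF assms, symmetric]) (rule row_len_eq_0[OF assms])
  finally show ?thesis .
qed

lemma inj_on_row_differences: "inj_on row_differences young"
proof (rule inj_onI)
  fix \<nu> \<kappa> assume young: "\<nu> \<in> young" "\<kappa> \<in> young" and eq: "row_differences \<nu> = row_differences \<kappa>"
  define L where "L = max (card \<nu>) (card \<kappa>)"
  have rec: "row_len \<mu> k = Poly_Mapping.lookup (row_differences \<mu>) k + row_len \<mu> (Suc k)"
    if "\<mu> \<in> young" for \<mu> k
    using row_len_antimono[OF that, of k "Suc k"] by (simp add: lookup_row_differences[OF that])
  \<comment> \<open>The rows are recovered from the last one upwards; row \<open>L\<close> is empty.\<close>
  have "row_len \<nu> (L - d) = row_len \<kappa> (L - d)" for d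
  proof (induction d)
    case 0
    then show ?case by (simp add: row_len_eq_0 young L_def)
  next
    case (Suc d)
    show ?case
    proof (cases "d < L")
      case True
      then have "Suc (L - Suc d) = L - d" by simp
      then show ?thesis using Suc rec[OF young(1), of "L - Suc d"] rec[OF young(2), of "L - Suc d"] eq by simp
    qed (use Suc in simp)
  qed
  then have "row_len \<nu> k = row_len \<kappa> k" for k
  proof (cases "k \<le> L")
    case True
    then show ?thesis using \<open>\<And>d. row_len \<nu> (L - d) = row_len \<kappa> (L - d)\<close>[of "L - k"] by simp
  qed (simp add: row_len_eq_0 young L_def)
  then show "\<nu> = \<kappa>" using young by (auto simp: young_mem_iff)
qed

interpretation sym: vector_space "scale :: real \<Rightarrow> real sym \<Rightarrow> real sym"
  by (rule vector_space_scale)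

interpretation csym: vector_space "scale :: complex \<Rightarrow> complex sym \<Rightarrow> complex sym"
  by (rule vector_space_scale)

interpretation symstar: Vector_Spaces.linear "scale :: real \<Rightarrow> real sym \<Rightarrow> real sym" seq_scale symstar_of
  by unfold_locales
     (auto simp: symstar_of_def seq_scale_def fun_eq_iff subst.hom_add subst_scale)

lemma monomials_independent:
  "\<not> module.dependent (scale :: 'a::field \<Rightarrow> 'a mpol \<Rightarrow> 'a mpol) (monomial ` A)"
proof -
  interpret vector_space "scale :: 'a \<Rightarrow> 'a mpol \<Rightarrow> 'a mpol" by (rule vector_space_scale)
  show ?thesis
  proof
    assume "dependent (monomial ` A :: 'a mpol set)"
    then obtain T u v where T: "finite T" "T \<subseteq> monomial ` A" "(\<Sum>w\<in>T. scale (u w) w) = 0"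
      and v: "v \<in> T" "u v \<noteq> (0::'a)"
      unfolding dependent_explicit by blast
    then obtain m where m: "v = monomial m" by auto
    have "0 = Poly_Mapping.lookup (\<Sum>w\<in>T. scale (u w) w) m" by (simp add: T(3))
    also have "\<dots> = (\<Sum>w\<in>T. if w = v then u v else 0)"
      unfolding lookup_sum lookup_scale
      by (intro sum.cong refl) (auto simp: m lookup_single when_def split: if_splits dest!: subsetD[OF T(2)])
    also have "\<dots> = u v" using T(1) v(1) by simp
    finally show False using v(2) by simp
  qed
qed

lemma inj_monomial: "inj (monomial :: _ \<Rightarrow> 'a::comm_ring_1 mpol)"
proof (rule injI)
  fix m m' assume *: "monomial m = (monomial m' :: 'a mpol)"
  have "Poly_Mapping.lookup (monomial m' :: 'a mpol) m = 1" by (simp flip: *)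
  then show "m = m'" by (auto simp: lookup_single when_def split: if_splits)
qed

lemma finite_weight_le: "finite {m. weight m \<le> n}"
proof (rule finite_subset)
  let ?f = "\<lambda>g. Abs_poly_mapping (\<lambda>k. if k < n then g k else 0)"
  show "{m. weight m \<le> n} \<subseteq> ?f ` ({..<n} \<rightarrow>\<^sub>E {..n})"
  proof
    fix m assume "m \<in> {m. weight m \<le> n}"
    then have le: "weight m \<le> n" by simp
    have bound: "Suc k * Poly_Mapping.lookup m k \<le> n" for k
    proof (cases "k \<in> Poly_Mapping.keys m")
      case True
      then have "Suc k * Poly_Mapping.lookup m k \<le> weight m"
        unfolding weight_def by (intro member_le_sum) auto
      then show ?thesis using le by simp
    qed (simp add: in_keys_iff)
    have "Poly_Mapping.lookup m k \<le> n" for k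
      by (rule order_trans[OF _ bound[of k]]) simp
    then have "restrict (Poly_Mapping.lookup m) {..<n} \<in> {..<n} \<rightarrow>\<^sub>E {..n}" by auto
    moreover have zero: "Poly_Mapping.lookup m k = 0" if "\<not> k < n" for k
      using bound[of k] that by (cases "Poly_Mapping.lookup m k") auto
    have "m = ?f (restrict (Poly_Mapping.lookup m) {..<n})"
    proof (rule poly_mapping_eqI)
      fix k
      have "finite {k. (if k < n then restrict (Poly_Mapping.lookup m) {..<n} k else 0) \<noteq> 0}"
        by (rule finite_subset[of _ "{..<n}"]) auto
      then show "Poly_Mapping.lookup m k = Poly_Mapping.lookup (?f (restrict (Poly_Mapping.lookup m) {..<n})) k"
        using zero[of k] by simp
    qed
    ultimately show "m \<in> ?f ` ({..<n} \<rightarrow>\<^sub>E {..n})" by blast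
  qed
qed (intro finite_imageI finite_PiE; simp)

lemma card_young_le_card_weight: "card {\<nu> \<in> young. card \<nu> \<le> n} \<le> card {m. weight m \<le> n}"
  using inj_on_row_differences weight_row_differences finite_weight_le
  by (intro card_inj_on_le[of row_differences]) (auto intro: inj_on_subset)

lemma schur_span_mono: "k \<le> n \<Longrightarrow> schur_span k \<subseteq> schur_span n"
  unfolding schur_span_def by (intro seq.span_mono) auto

text \<open>The independent images of the monomials of weight at most \<open>n\<close> lie in the span of the \<open>S\<^sup>*\<^sub>\<nu>\<close>,
  \<open>|\<nu>| \<le> n\<close>, and are no fewer. Hence each \<open>S\<^sup>*\<^sub>\<nu>\<close> is in turn a combination of these images, and the
  definite description behind \<open>FS \<nu>\<close> is satisfied.\<close>

lemma symstar_of_FS: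
  assumes "\<nu> \<in> young"
  shows "symstar_of (FS \<nu>) = shifted_schur \<nu>"
proof -
  let ?n = "card \<nu>"
  let ?M = "monomial ` {m. weight m \<le> ?n} :: real sym set"
  interpret vector_space_pair "scale :: real \<Rightarrow> real sym \<Rightarrow> real sym" seq_scale ..
  have "inj symstar_of" by (rule injI) (rule symstar_of_inject)
  have "shifted_schur ` {\<nu> \<in> young. card \<nu> \<le> ?n} \<subseteq> seq.span (symstar_of ` ?M)"
  proof (rule seq.spanning_family_is_basis(3))
    show "\<not> seq.dependent (symstar_of ` ?M)"
      using \<open>inj symstar_of\<close> monomials_independent
      by (intro linear_independent_injective_image symstar.linear_axioms) (auto intro: inj_on_subset)
    have "card (symstar_of ` ?M) = card {m. weight m \<le> ?n}"
      by (simp add: card_image inj_on_subset[OF \<open>inj symstar_of\<close>] inj_on_subset[OF inj_monomial])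
    then show "card {\<nu> \<in> young. card \<nu> \<le> ?n} \<le> card (symstar_of ` ?M)"
      using card_young_le_card_weight by simp
    show "symstar_of ` ?M \<subseteq> seq.span (shifted_schur ` {\<nu> \<in> young. card \<nu> \<le> ?n})"
      using symstar_of_monomial schur_span_mono unfolding schur_span_def[symmetric] by blast
  qed (rule finite_young_card_le)
  then have "shifted_schur \<nu> \<in> symstar_of ` sym.span ?M"
    using assms by (auto simp: symstar.span_image)
  then obtain F where F: "shifted_schur \<nu> = symstar_of F" by blast
  have "symstar_to_sym (shifted_schur \<nu>) = F"
    unfolding symstar_to_sym_def
  proof (rule the_equality)
    show "\<forall>N\<ge>1. subst (\<lambda>k. pstar (Suc k) N) F = shifted_schur \<nu> N"
      by (simp add: F symstar_of_def)
    fix G assume G: "\<forall>N\<ge>1. subst (\<lambda>k. pstar (Suc k) N) G = shifted_schur \<nu> N"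
    have "G - F = 0"
      by (rule pstar_independent) (simp add: G subst.hom_minus, simp add: F symstar_of_def)
    then show "G = F" by simp
  qed
  then show ?thesis by (simp add: FS_def F)
qed

lemma monomial_in_span_FS:
  assumes "weight m \<le> n"
  shows "monomial m \<in> sym.span (FS ` {\<nu> \<in> young. card \<nu> \<le> n})"
proof -
  have "symstar_of (monomial m) \<in> schur_span n"
    using symstar_of_monomial schur_span_mono[OF assms] by blast
  also have "schur_span n = seq.span (symstar_of ` FS ` {\<nu> \<in> young. card \<nu> \<le> n})"
    unfolding schur_span_def image_image
    by (intro arg_cong[where f = seq.span] image_cong refl) (simp add: symstar_of_FS)
  also have "\<dots> = symstar_of ` sym.span (FS ` {\<nu> \<in> young. card \<nu> \<le> n})"
    by (rule symstar.span_image)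
  finally show ?thesis using symstar_of_inject by blast
qed

lemma lookup_map_of_real:
  "Poly_Mapping.lookup (Poly_Mapping.map complex_of_real F) m = complex_of_real (Poly_Mapping.lookup F m)"
  by (simp add: Poly_Mapping.map.rep_eq when_def)

lemma complexification_span:
  assumes "F \<in> sym.span (FS ` B)"
  shows "Poly_Mapping.map complex_of_real F \<in> csym.span (FSC ` B)"
  using assms
proof (induction rule: sym.span_induct_alt)
  case base
  have "Poly_Mapping.map complex_of_real (0 :: real sym) = 0"
    by (rule poly_mapping_eqI) (simp add: lookup_map_of_real)
  then show ?case by (simp add: csym.span_zero)
next
  case (step c x y)
  then obtain \<nu> where \<nu>: "\<nu> \<in> B" "x = FS \<nu>" by auto
  have "Poly_Mapping.map complex_of_real (scale c x + y) =
      scale (complex_of_real c) (FSC \<nu>) + Poly_Mapping.map complex_of_real y"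
    by (rule poly_mapping_eqI) (simp add: lookup_map_of_real lookup_add lookup_scale FSC_def \<nu>)
  then show ?case
    using step \<nu>(1) by (simp add: csym.span_add csym.span_scale csym.span_base)
qed

text \<open>The same count over the complex numbers: the \<open>FSC \<nu>\<close> with \<open>|\<nu>| \<le> n\<close> span all monomials of weight
  at most \<open>n\<close>, and are no more numerous than these.\<close>

lemma FSC_bounded_basis:
  fixes n :: nat
  defines "B \<equiv> {\<nu> \<in> young. card \<nu> \<le> n}"
  shows "inj_on FSC B" "\<not> csym.dependent (FSC ` B)"
    "weight m \<le> n \<Longrightarrow> monomial m \<in> csym.span (FSC ` B)"
proof -
  let ?M = "monomial ` {m. weight m \<le> n} :: complex sym set"
  have span: "monomial m \<in> csym.span (FSC ` B)" if "weight m \<le> n" for m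
  proof -
    have "Poly_Mapping.map complex_of_real (monomial m) = monomial m" by simp
    then show ?thesis
      using complexification_span[OF monomial_in_span_FS[OF that]] by (simp add: B_def)
  qed
  then show "weight m \<le> n \<Longrightarrow> monomial m \<in> csym.span (FSC ` B)" by simp
  have "card ?M = card {m. weight m \<le> n}"
    by (intro card_image inj_on_subset[OF inj_monomial subset_UNIV])
  then have *: "finite B" "\<not> csym.dependent ?M" "card B \<le> card ?M" "?M \<subseteq> csym.span (FSC ` B)"
    using finite_young_card_le card_young_le_card_weight[of n] span
    by (auto simp: B_def monomials_independent)
  show "inj_on FSC B" "\<not> csym.dependent (FSC ` B)"
    using csym.spanning_family_is_basis(1,2)[OF *] by auto
qed

lemma inj_on_FSC: "inj_on FSC young"
proof (rule inj_onI)
  fix \<nu> \<kappa> assume *: "\<nu> \<in> young" "\<kappa> \<in> young" "FSC \<nu> = FSC \<kappa>"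
  then show "\<nu> = \<kappa>"
    by (intro inj_onD[OF FSC_bounded_basis(1)[of "max (card \<nu>) (card \<kappa>)"]]) auto
qed

lemma FSC_independent: "\<not> csym.dependent (FSC ` young)"
proof
  assume "csym.dependent (FSC ` young)"
  then obtain T where T: "finite T" "T \<subseteq> FSC ` young" "csym.dependent T"
    unfolding csym.dependent_explicit by blast
  then obtain Y where Y: "finite Y" "Y \<subseteq> young" "T = FSC ` Y" by (meson finite_subset_image)
  have "Y \<subseteq> {\<nu> \<in> young. card \<nu> \<le> (\<Sum>\<nu>\<in>Y. card \<nu>)}"
    using Y by (auto intro: member_le_sum)
  then have "T \<subseteq> FSC ` {\<nu> \<in> young. card \<nu> \<le> (\<Sum>\<nu>\<in>Y. card \<nu>)}" using Y(3) by blast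
  then show False using T(3) FSC_bounded_basis(2) csym.independent_mono by blast
qed

lemma FSC_span: "csym.span (FSC ` young) = UNIV"
proof -
  have mono: "monomial m \<in> csym.span (FSC ` young)" for m
    using FSC_bounded_basis(3)[of m "weight m"] csym.span_mono[of "FSC ` {\<nu> \<in> young. card \<nu> \<le> weight m}"]
    by auto
  have "F \<in> csym.span (FSC ` young)" for F
  proof -
    have "F = (\<Sum>m\<in>Poly_Mapping.keys F. Poly_Mapping.single m (Poly_Mapping.lookup F m))"
      by (rule sum_single_keys)
    also have "\<dots> = (\<Sum>m\<in>Poly_Mapping.keys F. scale (Poly_Mapping.lookup F m) (monomial m))"
      by (simp add: scale_def Const_def mult_single)
    also have "\<dots> \<in> csym.span (FSC ` young)"
      by (intro csym.span_sum csym.span_scale mono)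
    finally show ?thesis .
  qed
  then show ?thesis by auto
qed

section \<open>Standard tableaux\<close>

text \<open>The boxes of \<open>\<nu>\<close> that can be added to \<open>\<kappa>\<close>.\<close>

definition addable_within :: "diagram \<Rightarrow> diagram \<Rightarrow> diagram" where
  "addable_within \<nu> \<kappa> = {b \<in> \<nu> - \<kappa>. insert b \<kappa> \<in> young}"

lemma standard_tableauxD:
  assumes "T \<in> standard_tableaux s"
  shows "T \<in> extensional s" "bij_betw T s {1..card s}"
    "(i, j) \<in> s \<Longrightarrow> (i, j') \<in> s \<Longrightarrow> j < j' \<Longrightarrow> T (i, j) < T (i, j')"
    "(i, j) \<in> s \<Longrightarrow> (i', j) \<in> s \<Longrightarrow> i < i' \<Longrightarrow> T (i, j) < T (i', j)"
  using assms unfolding standard_tableaux_def by blast+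

lemma finite_standard_tableaux: "finite s \<Longrightarrow> finite (standard_tableaux s)"
  by (rule finite_subset[of _ "s \<rightarrow>\<^sub>E {1..card s}"], rule subsetI, rule PiE_I)
     (auto simp: standard_tableaux_def bij_betw_def extensional_def intro!: finite_PiE)

lemma standard_tableaux_first_box:
  assumes young: "\<nu> \<in> young" "\<kappa> \<in> young" and T: "T \<in> standard_tableaux (\<nu> - \<kappa>)"
    and b: "b \<in> \<nu> - \<kappa>" "T b = 1"
  shows "insert b \<kappa> \<in> young"
proof -
  obtain i j where ij: "b = (i, j)" by (cases b)
  note mono = standard_tableauxD(3,4)[OF T]
  have pos: "1 \<le> T x" if "x \<in> \<nu> - \<kappa>" for x
    using standard_tableauxD(2)[OF T] that by (force simp: bij_betw_def)
  have "(i', j') \<in> insert b \<kappa>" if le: "i' \<le> i" "j' \<le> j" for i' j'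
  proof (rule ccontr)
    assume not: "(i', j') \<notin> insert b \<kappa>"
    have in\<nu>: "(i', j') \<in> \<nu>" "(i', j) \<in> \<nu>" using youngD(2)[OF young(1)] b(1) le by (auto simp: ij)
    have "(i', j) \<notin> \<kappa>" using youngD(2)[OF young(2), of i' j i' j'] not le by auto
    then have in_s: "(i', j') \<in> \<nu> - \<kappa>" "(i', j) \<in> \<nu> - \<kappa>" "(i, j) \<in> \<nu> - \<kappa>"
      using in\<nu> not b(1) by (auto simp: ij)
    show False
    proof (cases "i' = i")
      case True
      then have "j' < j" using not le by (auto simp: ij le_less)
      then show False using mono(1)[OF in_s(1)[unfolded True] in_s(3)] pos[OF in_s(1)] b(2) True
        by (simp add: ij)
    next
      case False
      then show False using mono(2)[OF in_s(2,3)] pos[OF in_s(2)] b(2) le by (simp add: ij)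
    qed
  qed
  then show ?thesis using young(2) by (auto simp: young_def ij)
qed

text \<open>Removing the box \<open>b\<close> with entry 1 and lowering the other entries by 1 is a bijection.\<close>

lemma card_standard_tableaux_first_box:
  assumes young: "\<nu> \<in> young" and b: "b \<in> addable_within \<nu> \<kappa>"
  shows "card {T \<in> standard_tableaux (\<nu> - \<kappa>). T b = 1} = card (standard_tableaux (\<nu> - insert b \<kappa>))"
proof -
  let ?s = "\<nu> - \<kappa>" and ?s' = "\<nu> - insert b \<kappa>"
  have s: "?s = insert b ?s'" "b \<notin> ?s'" "b \<in> ?s" and fin: "finite ?s'" "finite ?s"
    using b youngD(1)[OF young] by (auto simp: addable_within_def)
  have "card ?s = card (insert b ?s')" by (rule arg_cong[OF s(1)])
  also have "\<dots> = Suc (card ?s')" using fin(1) s(2) by (rule card_insert_disjoint)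
  finally have card: "card ?s = Suc (card ?s')" .
  \<comment> \<open>No other box of the skew shape lies weakly above and to the left of \<open>b\<close>.\<close>
  have minimal: "x = b" if "x \<in> ?s" "fst x \<le> fst b" "snd x \<le> snd b" for x
  proof -
    have "(fst x, snd x) \<in> insert b \<kappa>"
      by (rule youngD(2)[of "insert b \<kappa>" "fst b" "snd b"]) (use b that(2,3) in \<open>auto simp: addable_within_def\<close>)
    then show ?thesis using that(1) by auto
  qed
  let ?f = "\<lambda>T. restrict (\<lambda>x. T x - 1) ?s'"
  let ?g = "\<lambda>T. restrict (\<lambda>x. if x = b then 1 else Suc (T x)) ?s"
  show ?thesis
  proof (rule bij_betw_same_card[OF bij_betw_byWitness[where f = ?f and f' = ?g]])
    have big: "2 \<le> T x" if "T \<in> standard_tableaux ?s" "T b = 1" "x \<in> ?s'" for T x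
    proof -
      have bij: "bij_betw T ?s {1..card ?s}" by (rule standard_tableauxD(2)[OF that(1)])
      have "x \<in> ?s" "x \<noteq> b" using that(3) by auto
      then have "T x \<noteq> T b" "T x \<in> {1..card ?s}"
        using bij s(3) by (auto simp: bij_betw_def inj_on_def)
      then show ?thesis using that(2) by auto
    qed
    show "\<forall>T\<in>{T \<in> standard_tableaux ?s. T b = 1}. ?g (?f T) = T"
    proof
      fix T assume T: "T \<in> {T \<in> standard_tableaux ?s. T b = 1}"
      then have ext: "T \<in> extensional ?s" using standard_tableauxD(1) by auto
      show "?g (?f T) = T"
      proof (rule extensionalityI[OF _ ext])
        fix x assume "x \<in> ?s"
        then show "?g (?f T) x = T x" using T big[of T x] by auto
      qed simp
    qed
    show "\<forall>T\<in>standard_tableaux ?s'. ?f (?g T) = T"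
    proof
      fix T assume T: "T \<in> standard_tableaux ?s'"
      show "?f (?g T) = T"
        by (rule extensionalityI[OF _ standard_tableauxD(1)[OF T]]) auto
    qed
    show "?f ` {T \<in> standard_tableaux ?s. T b = 1} \<subseteq> standard_tableaux ?s'"
    proof clarify
      fix T assume T: "T \<in> standard_tableaux ?s" "T b = 1"
      have "bij_betw T (?s - {b}) ({1..card ?s} - {T b})"
        using standard_tableauxD(2)[OF T(1)] bij_betw_apply[OF standard_tableauxD(2)[OF T(1)] s(3)] s(3)
        by (intro bij_betw_DiffI) (auto intro: bij_betw_singletonI)
      moreover have "?s - {b} = ?s'" by auto
      moreover have "{1..card ?s} - {T b} = {2..Suc (card ?s')}" by (auto simp: T card)
      ultimately have "bij_betw T ?s' {2..Suc (card ?s')}" by simp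
      moreover have "bij_betw (\<lambda>n. n - 1) {2..Suc (card ?s')} {1..card ?s'}"
        by (rule bij_betw_byWitness[where f' = Suc]) auto
      ultimately have "bij_betw ((\<lambda>n. n - 1) \<circ> T) ?s' {1..card ?s'}" by (rule bij_betw_trans)
      then have bij: "bij_betw (?f T) ?s' {1..card ?s'}"
        by (rule bij_betw_cong[THEN iffD1, rotated]) simp
      have less: "T x - 1 < T y - 1" if "x \<in> ?s'" "T x < T y" for x y
        using that big[OF T that(1)] by linarith
      show "?f T \<in> standard_tableaux ?s'"
        unfolding standard_tableaux_def
      proof (intro CollectI conjI allI impI)
        fix i j j' assume *: "(i, j) \<in> ?s'" "(i, j') \<in> ?s'" "j < j'"
        then have "T (i, j) < T (i, j')" by (intro standard_tableauxD(3)[OF T(1)]) auto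
        then show "?f T (i, j) < ?f T (i, j')" using * less by (simp del: One_nat_def)
      next
        fix i i' j assume *: "(i, j) \<in> ?s'" "(i', j) \<in> ?s'" "i < i'"
        then have "T (i, j) < T (i', j)" by (intro standard_tableauxD(4)[OF T(1)]) auto
        then show "?f T (i, j) < ?f T (i', j)" using * less by (simp del: One_nat_def)
      qed (use bij in auto)
    qed
    show "?g ` standard_tableaux ?s' \<subseteq> {T \<in> standard_tableaux ?s. T b = 1}"
    proof clarify
      fix T assume T: "T \<in> standard_tableaux ?s'"
      have "bij_betw Suc {1..card ?s'} {2..card ?s}"
        by (rule bij_betw_byWitness[where f' = "\<lambda>n. n - 1"]) (auto simp: card)
      with standard_tableauxD(2)[OF T] have "bij_betw (Suc \<circ> T) ?s' {2..card ?s}"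
        by (rule bij_betw_trans)
      then have "bij_betw (?g T) ?s' {2..card ?s}"
        by (rule bij_betw_cong[THEN iffD1, rotated]) auto
      moreover have "bij_betw (?g T) {b} {1}" using s(3) by (simp add: bij_betw_def)
      ultimately have "bij_betw (?g T) (?s' \<union> {b}) ({2..card ?s} \<union> {1})"
        by (rule bij_betw_combine) auto
      moreover have "?s' \<union> {b} = ?s" unfolding Un_insert_right sup_bot_right by (rule s(1)[symmetric])
      moreover have "{2..card ?s} \<union> {1} = {1..card ?s}" by (auto simp: card)
      ultimately have bij: "bij_betw (?g T) ?s {1..card ?s}" by simp
      have pos: "0 < T x" if "x \<in> ?s'" for x
        using standard_tableauxD(2)[OF T] that by (force simp: bij_betw_def)
      have "?g T \<in> standard_tableaux ?s"
        unfolding standard_tableaux_def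
      proof (intro CollectI conjI allI impI)
        fix i j j' assume *: "(i, j) \<in> ?s" "(i, j') \<in> ?s" "j < j'"
        then have "(i, j') \<noteq> b" using minimal[of "(i, j)"] by auto
        then show "?g T (i, j) < ?g T (i, j')"
          using * standard_tableauxD(3)[OF T, of i j j'] pos[of "(i, j')"] by auto
      next
        fix i i' j assume *: "(i, j) \<in> ?s" "(i', j) \<in> ?s" "i < i'"
        then have "(i', j) \<noteq> b" using minimal[of "(i, j)"] by auto
        then show "?g T (i, j) < ?g T (i', j)"
          using * standard_tableauxD(4)[OF T, of i j i'] pos[of "(i', j)"] by auto
      qed (use bij in auto)
      then show "?g T \<in> standard_tableaux ?s \<and> ?g T b = 1" using s(3) by simp
    qed
  qed
qed

lemma skew_dim_recursion:
  assumes young: "\<nu> \<in> young" "\<kappa> \<in> young" and sub: "\<kappa> \<subset> \<nu>"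
  shows "skew_dim \<nu> \<kappa> = (\<Sum>b\<in>addable_within \<nu> \<kappa>. skew_dim \<nu> (insert b \<kappa>))"
proof -
  let ?S = "standard_tableaux (\<nu> - \<kappa>)" and ?A = "addable_within \<nu> \<kappa>"
  have fin: "finite (\<nu> - \<kappa>)" "finite ?A"
    using youngD(1)[OF young(1)] by (auto simp: addable_within_def)
  have nonempty: "card (\<nu> - \<kappa>) \<noteq> 0" using fin sub by auto
  have "?S = (\<Union>b\<in>?A. {T \<in> ?S. T b = 1})"
  proof (intro equalityI subsetI)
    fix T assume T: "T \<in> ?S"
    have "1 \<in> T ` (\<nu> - \<kappa>)"
      using standard_tableauxD(2)[OF T] nonempty by (simp add: bij_betw_def)
    then obtain b where b: "b \<in> \<nu> - \<kappa>" "T b = 1" by auto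
    then have "b \<in> ?A"
      using standard_tableaux_first_box[OF young T b] by (simp add: addable_within_def)
    then show "T \<in> (\<Union>b\<in>?A. {T \<in> ?S. T b = 1})" using T b(2) by auto
  qed auto
  then have "card ?S = card (\<Union>b\<in>?A. {T \<in> ?S. T b = 1})" by simp
  also have "\<dots> = (\<Sum>b\<in>?A. card {T \<in> ?S. T b = 1})"
  proof (rule card_UN_disjoint[OF fin(2)])
    show "\<forall>b\<in>?A. finite {T \<in> ?S. T b = 1}" using finite_standard_tableaux[OF fin(1)] by auto
    show "\<forall>b\<in>?A. \<forall>b'\<in>?A. b \<noteq> b' \<longrightarrow> {T \<in> ?S. T b = 1} \<inter> {T \<in> ?S. T b' = 1} = {}"
    proof (intro ballI impI)
      fix b b' assume b: "b \<in> ?A" "b' \<in> ?A" "b \<noteq> b'"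
      have ne: "T b \<noteq> T b'" if "T \<in> ?S" for T
        using standard_tableauxD(2)[OF that] b by (auto simp: bij_betw_def inj_on_def addable_within_def)
      show "{T \<in> ?S. T b = 1} \<inter> {T \<in> ?S. T b' = 1} = {}"
      proof (rule equals0I)
        fix T assume "T \<in> {T \<in> ?S. T b = 1} \<inter> {T \<in> ?S. T b' = 1}"
        then show False using ne[of T] by simp
      qed
    qed
  qed
  also have "\<dots> = (\<Sum>b\<in>?A. skew_dim \<nu> (insert b \<kappa>))"
    unfolding skew_dim_def
    by (intro sum.cong refl card_standard_tableaux_first_box[OF young(1)])
  finally show ?thesis by (simp add: skew_dim_def)
qed

lemma skew_dim_self: "skew_dim \<nu> \<nu> = 1"
proof -
  have "standard_tableaux {} = {\<lambda>_. undefined}"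
    by (auto simp: standard_tableaux_def bij_betw_def)
  then show ?thesis by (simp add: skew_dim_def)
qed

section \<open>The Meixner operator and its eigenvectors\<close>

interpretation csym_pair: vector_space_pair
  "scale :: complex \<Rightarrow> complex sym \<Rightarrow> complex sym" "scale :: complex \<Rightarrow> complex sym \<Rightarrow> complex sym" ..

text \<open>As the \<open>FSC \<nu>\<close> form a basis, exactly one linear operator has the prescribed values on them.\<close>

lemma meixner_operator_properties:
  "Vector_Spaces.linear scale scale (meixner_operator z z' \<xi>) \<and>
   (\<forall>\<nu> \<in> young. meixner_operator z z' \<xi> (FSC \<nu>) =
      scale (- of_nat (card \<nu>)) (FSC \<nu>)
    + scale (\<xi> / (1 - \<xi>))
        (\<Sum>b \<in> removable \<nu>.
           scale ((z + of_int (content b)) * (z' + of_int (content b))) (FSC (\<nu> - {b}))))"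
    (is "?P (meixner_operator z z' \<xi>)")
proof -
  let ?v = "\<lambda>\<nu>. scale (- of_nat (card \<nu>)) (FSC \<nu>) + scale (\<xi> / (1 - \<xi>))
        (\<Sum>b \<in> removable \<nu>.
           scale ((z + of_int (content b)) * (z' + of_int (content b))) (FSC (\<nu> - {b})))"
  obtain D where D: "Vector_Spaces.linear scale scale D"
    "\<forall>x\<in>FSC ` young. D x = ?v (inv_into young FSC x)"
    using csym_pair.linear_independent_extend[OF FSC_independent, of "\<lambda>x. ?v (inv_into young FSC x)"]
    by (elim exE conjE)
  then have "?P D" by (simp add: inv_into_f_f inj_on_FSC)
  moreover have "D' = D" if "?P D'" for D'
  proof
    fix x
    show "D' x = D x"
      using that \<open>?P D\<close> FSC_span
      by (intro csym_pair.linear_eq_on[of D' D x "FSC ` young"]) auto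
  qed
  ultimately have "\<exists>!D. ?P D" by (rule ex1I)
  from theI'[OF this] show ?thesis unfolding meixner_operator_def .
qed

text \<open>The coefficient of \<open>FSC \<mu>\<close> in the Meixner function, with \<open>t\<close> for \<open>\<xi> / (1 - \<xi>)\<close>.\<close>

definition meixner_coeff :: "complex \<Rightarrow> complex \<Rightarrow> complex \<Rightarrow> diagram \<Rightarrow> diagram \<Rightarrow> complex" where
  "meixner_coeff z z' t \<nu> \<mu> =
     (- 1) ^ (card \<nu> - card \<mu>) * t ^ (card \<nu> - card \<mu>)
       * (of_nat (skew_dim \<nu> \<mu>) / fact (card \<nu> - card \<mu>))
       * skew_poch z \<nu> \<mu> * skew_poch z' \<nu> \<mu>"

lemma meixner_function_eq:
  "meixner_function z z' \<xi> \<nu> =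
     (\<Sum>\<mu> \<in> {\<mu> \<in> young. \<mu> \<subseteq> \<nu>}. scale (meixner_coeff z z' (\<xi> / (1 - \<xi>)) \<nu> \<mu>) (FSC \<mu>))"
  by (simp add: meixner_function_def meixner_coeff_def)

lemma skew_poch_insert:
  assumes "finite \<nu>" "b \<in> \<nu> - \<kappa>"
  shows "skew_poch z \<nu> \<kappa> = (z + of_int (content b)) * skew_poch z \<nu> (insert b \<kappa>)"
proof -
  have "\<nu> - \<kappa> - {b} = \<nu> - insert b \<kappa>" by auto
  then show ?thesis using assms unfolding skew_poch_def by (subst prod.remove[of _ b]) auto
qed

text \<open>The eigenvalue equation compared at \<open>FSC \<kappa>\<close>: the coefficients of the diagrams \<open>\<kappa>\<close> plus one box
  feed into that of \<open>\<kappa>\<close>.\<close>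

lemma meixner_coeff_recursion:
  assumes young: "\<nu> \<in> young" "\<kappa> \<in> young" and sub: "\<kappa> \<subseteq> \<nu>"
  shows "(\<Sum>b\<in>addable_within \<nu> \<kappa>. meixner_coeff z z' t \<nu> (insert b \<kappa>) *
        (t * ((z + of_int (content b)) * (z' + of_int (content b)))))
    = (of_nat (card \<kappa>) - of_nat (card \<nu>)) * meixner_coeff z z' t \<nu> \<kappa>"
proof (cases "\<kappa> = \<nu>")
  case True
  then show ?thesis by (simp add: addable_within_def)
next
  case False
  note fin = youngD(1)[OF young(1)] youngD(1)[OF young(2)]
  have less: "card \<kappa> < card \<nu>" using fin sub False by (intro psubset_card_mono) auto
  define e where "e = card \<nu> - Suc (card \<kappa>)"
  have d: "card \<nu> - card \<kappa> = Suc e" "card \<nu> = card \<kappa> + Suc e" using less by (simp_all add: e_def)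
  let ?c = "(- 1) ^ e * t ^ Suc e / fact e * skew_poch z \<nu> \<kappa> * skew_poch z' \<nu> \<kappa>"
  have "meixner_coeff z z' t \<nu> (insert b \<kappa>) *
        (t * ((z + of_int (content b)) * (z' + of_int (content b))))
      = ?c * of_nat (skew_dim \<nu> (insert b \<kappa>))" if b: "b \<in> addable_within \<nu> \<kappa>" for b
  proof -
    have b': "b \<in> \<nu> - \<kappa>" using b by (simp add: addable_within_def)
    then have "card \<nu> - card (insert b \<kappa>) = e" using fin by (simp add: e_def)
    then show ?thesis
      unfolding meixner_coeff_def skew_poch_insert[OF fin(1) b'] by (simp add: mult_ac)
  qed
  then have "(\<Sum>b\<in>addable_within \<nu> \<kappa>. meixner_coeff z z' t \<nu> (insert b \<kappa>) *
        (t * ((z + of_int (content b)) * (z' + of_int (content b)))))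
      = (\<Sum>b\<in>addable_within \<nu> \<kappa>. ?c * of_nat (skew_dim \<nu> (insert b \<kappa>)))"
    by (rule sum.cong[OF refl])
  also have "\<dots> = ?c * of_nat (skew_dim \<nu> \<kappa>)"
    using skew_dim_recursion[OF young] sub False by (simp add: sum_distrib_left psubset_eq)
  also have "\<dots> = (of_nat (card \<kappa>) - of_nat (card \<nu>)) * meixner_coeff z z' t \<nu> \<kappa>"
  proof -
    have "fact (Suc e) = (of_nat (Suc e) :: complex) * fact e" by simp
    moreover have "of_nat (card \<kappa>) - of_nat (card \<nu>) = - (of_nat (Suc e) :: complex)"
      by (simp add: d(2))
    moreover have "of_nat (Suc e) \<noteq> (0 :: complex)" "fact e \<noteq> (0 :: complex)"
      by (simp_all del: of_nat_Suc)
    ultimately show ?thesis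
      unfolding meixner_coeff_def d(1) by (simp add: divide_simps del: of_nat_Suc)
  qed
  finally show ?thesis .
qed

theorem proposition4p24:
  fixes z z' \<xi> :: complex and \<nu> :: diagram
  assumes "\<xi> \<noteq> 1" and "\<nu> \<in> young"
  shows "meixner_function z z' \<xi> \<nu> \<noteq> 0 \<and>
         meixner_operator z z' \<xi> (meixner_function z z' \<xi> \<nu>) =
           scale (- of_nat (card \<nu>)) (meixner_function z z' \<xi> \<nu>)"
proof
  let ?Y = "{\<mu> \<in> young. \<mu> \<subseteq> \<nu>}"
  define t where "t = \<xi> / (1 - \<xi>)"
  define c where "c = meixner_coeff z z' t \<nu>"
  define w where "w b = (z + of_int (content b)) * (z' + of_int (content b))" for b
  have M: "meixner_function z z' \<xi> \<nu> = (\<Sum>\<mu>\<in>?Y. scale (c \<mu>) (FSC \<mu>))"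
    by (simp add: meixner_function_eq c_def t_def)
  have fin\<nu>: "finite \<nu>" using assms(2) by (rule youngD)
  have finY: "finite ?Y" using fin\<nu> by (intro finite_subset[of ?Y "Pow \<nu>"]) auto
  show "meixner_function z z' \<xi> \<nu> \<noteq> 0"
  proof
    assume 0: "meixner_function z z' \<xi> \<nu> = 0"
    have "(\<Sum>x\<in>FSC ` ?Y. scale (c (inv_into young FSC x)) x) = (\<Sum>\<mu>\<in>?Y. scale (c \<mu>) (FSC \<mu>))"
      by (subst sum.reindex) (auto intro: inj_on_subset[OF inj_on_FSC] simp: inv_into_f_f[OF inj_on_FSC])
    also have "\<dots> = 0" using 0 M by simp
    finally have "csym.dependent (FSC ` young)"
      unfolding csym.dependent_explicit
      using finY assms(2)
      by (intro exI[of _ "FSC ` ?Y"] exI[of _ "\<lambda>x. c (inv_into young FSC x)"])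
         (auto simp: inv_into_f_f[OF inj_on_FSC] c_def meixner_coeff_def skew_dim_self skew_poch_def
            intro!: bexI[of _ "\<nu>"])
    then show False using FSC_independent by simp
  qed
  let ?D = "meixner_operator z z' \<xi>"
  interpret D: Vector_Spaces.linear scale scale ?D
    using meixner_operator_properties by blast
  have D_FSC: "?D (FSC \<mu>) = scale (- of_nat (card \<mu>)) (FSC \<mu>)
      + scale t (\<Sum>b \<in> removable \<mu>. scale (w b) (FSC (\<mu> - {b})))" if "\<mu> \<in> young" for \<mu>
    using meixner_operator_properties that unfolding t_def w_def by blast
  have fin: "finite \<mu>" if "\<mu> \<in> ?Y" for \<mu> using that youngD(1) by auto
  have "?D (meixner_function z z' \<xi> \<nu>) = (\<Sum>\<mu>\<in>?Y. scale (c \<mu>) (?D (FSC \<mu>)))"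
    by (simp add: M D.sum D.scale)
  also have "\<dots> = (\<Sum>\<mu>\<in>?Y. scale (c \<mu> * - of_nat (card \<mu>)) (FSC \<mu>))
      + (\<Sum>\<mu>\<in>?Y. \<Sum>b \<in> removable \<mu>. scale (c \<mu> * (t * w b)) (FSC (\<mu> - {b})))"
    unfolding sum.distrib[symmetric]
  proof (intro sum.cong refl)
    fix \<mu> assume "\<mu> \<in> ?Y"
    then have "\<mu> \<in> young" by simp
    then show "scale (c \<mu>) (?D (FSC \<mu>)) = scale (c \<mu> * - of_nat (card \<mu>)) (FSC \<mu>)
        + (\<Sum>b \<in> removable \<mu>. scale (c \<mu> * (t * w b)) (FSC (\<mu> - {b})))"
      by (simp only: D_FSC csym.scale_right_distrib csym.scale_sum_right csym.scale_scale)
  qed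
  \<comment> \<open>Reindexing by \<open>\<kappa> = \<mu> - {b}\<close>.\<close>
  also have "(\<Sum>\<mu>\<in>?Y. \<Sum>b \<in> removable \<mu>. scale (c \<mu> * (t * w b)) (FSC (\<mu> - {b})))
      = (\<Sum>\<kappa>\<in>?Y. \<Sum>b \<in> addable_within \<nu> \<kappa>. scale (c (insert b \<kappa>) * (t * w b)) (FSC \<kappa>))"
  proof -
    have "finite (removable \<mu>)" if "\<mu> \<in> ?Y" for \<mu>
      using fin[OF that] by (simp add: removable_def)
    moreover have "finite (addable_within \<nu> \<kappa>)" for \<kappa>
      using fin\<nu> by (simp add: addable_within_def)
    ultimately have "\<forall>\<mu>\<in>?Y. finite (removable \<mu>)" "\<forall>\<kappa>\<in>?Y. finite (addable_within \<nu> \<kappa>)"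
      by blast+
    then show ?thesis
      by (subst (1 2) sum.Sigma[OF finY], simp, simp)
         (intro sum.reindex_bij_witness[of _ "\<lambda>(\<kappa>, b). (insert b \<kappa>, b)" "\<lambda>(\<mu>, b). (\<mu> - {b}, b)"];
          auto simp: removable_def addable_within_def insert_absorb)
  qed
  also have "\<dots> = (\<Sum>\<kappa>\<in>?Y. scale ((of_nat (card \<kappa>) - of_nat (card \<nu>)) * c \<kappa>) (FSC \<kappa>))"
    unfolding csym.scale_sum_left[symmetric] c_def w_def
    by (intro sum.cong refl) (simp add: meixner_coeff_recursion assms(2))
  also have "(\<Sum>\<mu>\<in>?Y. scale (c \<mu> * - of_nat (card \<mu>)) (FSC \<mu>)) + \<dots>
      = (\<Sum>\<mu>\<in>?Y. scale (- of_nat (card \<nu>) * c \<mu>) (FSC \<mu>))"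
    unfolding sum.distrib[symmetric] csym.scale_left_distrib[symmetric]
    by (intro sum.cong refl arg_cong2[where f = scale]) (simp add: algebra_simps)
  also have "\<dots> = scale (- of_nat (card \<nu>)) (meixner_function z z' \<xi> \<nu>)"
    by (simp add: M csym.scale_sum_right)
  finally show "?D (meixner_function z z' \<xi> \<nu>) = scale (- of_nat (card \<nu>)) (meixner_function z z' \<xi> \<nu>)" .
qed

end
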